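(* Let $f:\mathbb{D}\to\widehat{\mathbb{C}}$ be a spherically convex function. Then $$A_s f(r\mathbb{D})\ge\frac{\pi r^2}{1+r^2f^{\sharp}(0)^2}\,f^{\sharp}(0)^2\quad\text{for every } 0<r<1.$$ Moreover, equality holds for any $0<r<1$ if $f$ has the form $f(z)=T(\eta z)$ with $T\in\mathrm{Rot}(\widehat{\mathbb{C}})$ and $0<|\eta|\le 1$ ($\eta\in\mathbb{C}$).
   Context: $\mathbb{D}=\{z\in\mathbb{C}:|z|<1\}$, $\widehat{\mathbb{C}}=\mathbb{C}\cup\{\infty\}$ is the Riemann sphere with the spherical metric $\frac{|dz|}{1+|z|^2}$ (Gaussian curvature $+4$). For two non-antipodal points $a,b\in\widehat{\mathbb{C}}$, the spherical geodesic joining them is the smaller arc of the great circle through $a$ and $b$. A domain $\Omega\subset\widehat{\mathbb{C}}$ is spherically convex if for any two points $a,b\in\Omega$ that are not antipodal the spherical geodesic joining $a$ and $b$ lies in $\Omega$. A meromorphic univalent (injective) map $f:\mathbb{D}\to\widehat{\mathbb{C}}$ is called spherically convex if $f(\mathbb{D})$ is a spherically convex domain. The group of (meromorphic) spherical isometries is $$\mathrm{Rot}(\widehat{\mathbb{C}})=\left\{e^{i\theta}\frac{z-a}{1+z\overline{a}}: a\in\mathbb{C},\theta\in\mathbb{R}\right\}\cup\left\{\frac{e^{i\theta}}{z}:\theta\in\mathbb{R}\right\}.$$ The spherical derivative is $f^{\sharp}(z)=\frac{|f'(z)|}{1+|f(z)|^2}$ (at a pole of $f$ defined by continuous extension). With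 $dA$ Lebesgue area measure and $r\mathbb{D}=\{|z|<r\}$, $$A_s f(r\mathbb{D})=\iint_{r\mathbb{D}}f^{\sharp}(z)^2\,dA(z).$$ *)

theory Defs
  imports "HOL-Complex_Analysis.Complex_Analysis"
begin

text \<open>The Riemann sphere is the one-point compactification of \<open>\<complex>\<close>, with \<open>None\<close> as the
  point at infinity.\<close>

type_synonym riemann_sphere = "complex option"

abbreviation riemann_sphere_topology :: "riemann_sphere topology" where
  "riemann_sphere_topology \<equiv> Alexandroff_compactification euclidean"

text \<open>Stereographic projection onto the unit sphere of \<open>\<complex> \<times> \<real>\<close>, with infinity as the north
  pole. The metric \<open>|dz| / (1 + |z|\<^sup>2)\<close> corresponds to half of the metric of the unit sphere, so
  that great circles and antipodal points are those of the unit sphere.\<close>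

fun stereo :: "riemann_sphere \<Rightarrow> complex \<times> real" where
  "stereo None = (0, 1)"
| "stereo (Some z) =
    ((2 / (1 + (cmod z)\<^sup>2)) *\<^sub>R z, ((cmod z)\<^sup>2 - 1) / (1 + (cmod z)\<^sup>2))"

definition antipodal :: "riemann_sphere \<Rightarrow> riemann_sphere \<Rightarrow> bool" where
  "antipodal a b \<longleftrightarrow> stereo b = - stereo a"

text \<open>The great circles through \<open>p\<close> are the curves \<open>t \<mapsto> cos t p + sin t u\<close> for unit vectors \<open>u\<close>
  orthogonal to \<open>p\<close>, parametrised by arc length on the unit sphere. The smaller arc from \<open>p\<close> to
  a point \<open>q \<noteq> -p\<close> is the one of length \<open>l < \<pi>\<close>. It is \<open>{p}\<close> if \<open>q = p\<close>.\<close>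

definition spherical_geodesic :: "riemann_sphere \<Rightarrow> riemann_sphere \<Rightarrow> riemann_sphere set" where
  "spherical_geodesic a b =
    {x. \<exists>u l t. norm u = 1 \<and> u \<bullet> stereo a = 0 \<and> 0 \<le> t \<and> t \<le> l \<and> l < pi \<and>
          stereo b = cos l *\<^sub>R stereo a + sin l *\<^sub>R u \<and>
          stereo x = cos t *\<^sub>R stereo a + sin t *\<^sub>R u}"

definition spherically_convex_domain :: "riemann_sphere set \<Rightarrow> bool" where
  "spherically_convex_domain \<Omega> \<longleftrightarrow>
    \<Omega> \<noteq> {} \<and> openin riemann_sphere_topology \<Omega> \<and> connectedin riemann_sphere_topology \<Omega> \<and>
    (\<forall>a\<in>\<Omega>. \<forall>b\<in>\<Omega>. \<not> antipodal a b \<longrightarrow> spherical_geodesic a b \<subseteq> \<Omega>)"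

text \<open>In the library, a meromorphic function is complex-valued, and a nicely meromorphic one has
  no removable discontinuities; its poles are the points sent to infinity.\<close>

definition sphere_meromorphic_on :: "(complex \<Rightarrow> riemann_sphere) \<Rightarrow> complex set \<Rightarrow> bool" where
  "sphere_meromorphic_on f A \<longleftrightarrow>
    (\<exists>F. F nicely_meromorphic_on A \<and>
         (\<forall>z\<in>A. f z = (if is_pole F z then None else Some (F z))))"

definition spherically_convex_function :: "(complex \<Rightarrow> riemann_sphere) \<Rightarrow> bool" where
  "spherically_convex_function f \<longleftrightarrow>
    sphere_meromorphic_on f (ball 0 1) \<and> inj_on f (ball 0 1) \<and>
    spherically_convex_domain (f ` ball 0 1)"

definition linear_fractional ::
    "complex \<Rightarrow> complex \<Rightarrow> complex \<Rightarrow> complex \<Rightarrow> riemann_sphere \<Rightarrow> riemann_sphere" where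
  "linear_fractional a b c d w =
    (case w of
       None \<Rightarrow> if c = 0 then None else Some (a / c)
     | Some z \<Rightarrow> if c * z + d = 0 then None else Some ((a * z + b) / (c * z + d)))"

text \<open>The maps \<open>e\<^sup>i\<^sup>\<theta> (z - a) / (1 + z cnj a)\<close> and \<open>e\<^sup>i\<^sup>\<theta> / z\<close>.\<close>

definition Rot :: "(riemann_sphere \<Rightarrow> riemann_sphere) set" where
  "Rot = {linear_fractional (cis \<theta>) (- cis \<theta> * a) (cnj a) 1 | a \<theta>. True} \<union>
         {linear_fractional 0 (cis \<theta>) 1 0 | \<theta>. True}"

text \<open>Near a pole of a meromorphic \<open>f\<close> there is no other pole, so that the limit below is one of
  values given by the first case.\<close>

definition finite_part :: "(complex \<Rightarrow> riemann_sphere) \<Rightarrow> complex \<Rightarrow> complex" where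
  "finite_part f z = (case f z of None \<Rightarrow> 0 | Some w \<Rightarrow> w)"

definition spherical_deriv :: "(complex \<Rightarrow> riemann_sphere) \<Rightarrow> complex \<Rightarrow> real" where
  "spherical_deriv f z =
    (let g = (\<lambda>w. cmod (deriv (finite_part f) w) / (1 + (cmod (finite_part f w))\<^sup>2))
     in if f z \<noteq> None then g z else Lim (at z) g)"

definition spherical_area :: "(complex \<Rightarrow> riemann_sphere) \<Rightarrow> real \<Rightarrow> real" where
  "spherical_area f r = (LINT z:ball 0 r|lebesgue. (spherical_deriv f z)\<^sup>2)"

end

theory Submission
  imports Defs
begin

text \<open>
  Why the theorem is true. The image of a spherically convex function \<open>f\<close> contains no pair of
  antipodal points: a spherically convex domain with such a pair is the whole sphere
  (\<open>convex_domain_antipodal_UNIV\<close>), and by Liouville's theorem the disk is not mapped univalently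
  onto the sphere (\<open>sphere_meromorphic_not_surj\<close>). Hence, after a rotation that takes \<open>f(0)\<close> to
  \<open>0\<close>, the value \<open>\<infinity>\<close> is omitted, and \<open>f = T \<circ> g\<close> with a rotation \<open>T\<close> and a holomorphic \<open>g\<close> with
  \<open>g(0) = 0\<close> (\<open>spherically_convex_normalization\<close>). Rotations preserve the spherical derivative
  (\<open>spherical_deriv_Rot\<close>), so it remains to bound the spherical area of \<open>g\<close> from below
  (\<open>holomorphic_area_ge\<close>).

  Write \<open>h\<^sup># = |h'| / (1 + |h|\<^sup>2)\<close>. Since \<open>log(1 + |h|\<^sup>2) / 4\<close> has the Laplacian \<open>(h\<^sup>#)\<^sup>2\<close>, the
  divergence theorem expresses the spherical area of \<open>h\<close> on the disk of radius \<open>r\<close> as the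
  boundary integral \<open>flux h r = (\<integral> Re (z h' cnj h) / (1 + |h|\<^sup>2) d\<theta>) / 2\<close>. For \<open>F(z) = r g(z) / z\<close> this
  gives, on the circle \<open>|z| = r\<close>, the identity

    \<open>flux g r = height F r + flux F r\<close>, where \<open>height F \<rho> = (\<integral> |F|\<^sup>2 / (1 + |F|\<^sup>2) d\<theta>) / 2\<close>.

  The key point is that \<open>height F \<rho> + flux F \<rho>\<close> is an increasing function of \<open>\<rho>\<close>. In fact, the
  \<open>\<rho>\<close>-derivative of the height is, up to a factor \<open>\<rho>\<close>, the signed area integral of the closed
  plane curve \<open>\<theta> \<mapsto> Y(\<rho> e\<^sup>i\<^sup>\<theta>)\<close> with \<open>Y = F / (1 + |F|\<^sup>2)\<close>. By Hurwitz' proof of the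
  isoperimetric inequality (\<open>planar_isoperimetric\<close>) it is bounded by \<open>\<integral> |Y\<^sub>\<theta>|\<^sup>2 d\<theta>\<close>, hence by
  \<open>\<integral> \<rho>\<^sup>2 (F\<^sup>#)\<^sup>2 d\<theta>\<close>, because \<open>2 Y\<close> is the horizontal part of the stereographic image of \<open>F\<close>; and
  the latter integral is \<open>\<rho>\<close> times the derivative of the flux. At \<open>\<rho> = 0\<close> the sum is
  \<open>\<pi> |F(0)|\<^sup>2 / (1 + |F(0)|\<^sup>2)\<close>, which is the asserted bound since \<open>|F(0)| = r |g'(0)|\<close>.

  If \<open>f(z) = T(\<eta> z)\<close>, then \<open>g(z) = \<eta> z\<close>, and the flux is explicit.
\<close>

section \<open>Wirtinger's inequality and the isoperimetric inequality in the plane\<close>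

text \<open>With \<open>G = g\<^sup>2 cot(t - a)\<close> one has \<open>g'\<^sup>2 - g\<^sup>2 - G' = (g' - g cot(t - a))\<^sup>2 \<ge> 0\<close>, and \<open>G\<close> contributes
  nothing to the integral: \<open>g\<close> vanishes to first order at the simple poles \<open>a\<close> and \<open>a + \<pi>\<close> of
  the cotangent, so that \<open>G\<close> tends to \<open>0\<close> there.\<close>

lemma wirtinger_dirichlet:
  fixes g g' :: "real \<Rightarrow> real"
  assumes g: "\<And>t. t \<in> {a..a + pi} \<Longrightarrow> (g has_real_derivative g' t) (at t within {a..a + pi})"
    and cont: "continuous_on {a..a + pi} g'"
    and zero: "g a = 0" "g (a + pi) = 0"
  shows "integral {a..a + pi} (\<lambda>t. (g t)\<^sup>2) \<le> integral {a..a + pi} (\<lambda>t. (g' t)\<^sup>2)"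
proof -
  define G where "G t = (g t)\<^sup>2 * cot (t - a)" for t
  define G' where "G' t = 2 * g t * g' t * cot (t - a) - (g t)\<^sup>2 * (1 + (cot (t - a))\<^sup>2)" for t
  have sin_pos: "sin (t - a) > 0" if "t \<in> {a<..<a + pi}" for t
    using that by (intro sin_gt_zero) auto
  have contg: "continuous_on {a..a + pi} g"
    using g by (meson has_field_derivative_imp_has_derivative has_derivative_continuous_on)
  have lim: "((\<lambda>t. (g t)\<^sup>2 * cot (t - a)) \<longlongrightarrow> 0) (at x within {a..a + pi})"
    if x: "x = a \<or> x = a + pi" for x
  proof -
    have sx: "sin (x - a) = 0" and cx: "cos (x - a) \<noteq> 0" and gx: "g x = 0"
      using x zero by auto
    have xin: "x \<in> {a..a + pi}" using x by auto
    have "((\<lambda>t. (g t - g x) / (t - x)) \<longlongrightarrow> g' x) (at x within {a..a + pi})"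
      using g[OF xin] by (simp add: has_field_derivative_iff)
    then have 1: "((\<lambda>t. g t / (t - x)) \<longlongrightarrow> g' x) (at x within {a..a + pi})"
      using gx by simp
    have "((\<lambda>t. sin (t - a)) has_real_derivative cos (x - a)) (at x within {a..a + pi})"
      by (auto intro!: derivative_eq_intros)
    then have 2: "((\<lambda>t. sin (t - a) / (t - x)) \<longlongrightarrow> cos (x - a)) (at x within {a..a + pi})"
      using sx by (simp add: has_field_derivative_iff)
    have 3: "(g \<longlongrightarrow> 0) (at x within {a..a + pi})"
      using contg xin gx by (metis continuous_on)
    have 4: "((\<lambda>t. cos (t - a)) \<longlongrightarrow> cos (x - a)) (at x within {a..a + pi})"
      by (intro tendsto_intros)
    have "((\<lambda>t. g t * (g t / (t - x)) / (sin (t - a) / (t - x)) * cos (t - a)) \<longlongrightarrow> 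
        0 * g' x / cos (x - a) * cos (x - a)) (at x within {a..a + pi})"
      by (intro tendsto_intros 1 2 3 4 cx)
    moreover have "\<forall>\<^sub>F t in at x within {a..a + pi}. 
        g t * (g t / (t - x)) / (sin (t - a) / (t - x)) * cos (t - a) = (g t)\<^sup>2 * cot (t - a)"
      unfolding eventually_at_filter
      by (auto simp: cot_def power2_eq_square)
    ultimately show ?thesis
      by (simp add: tendsto_cong)
  qed
  have contG: "continuous_on {a..a + pi} G"
    unfolding continuous_on
  proof
    fix x assume x: "x \<in> {a..a + pi}"
    show "(G \<longlongrightarrow> G x) (at x within {a..a + pi})"
    proof (cases "x = a \<or> x = a + pi")
      case True
      then have "G x = 0" using zero by (auto simp: G_def)
      moreover have "(G \<longlongrightarrow> 0) (at x within {a..a + pi})"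
        using lim[OF True] unfolding G_def[abs_def] .
      ultimately show ?thesis by simp
    next
      case False
      with x sin_pos have "sin (x - a) \<noteq> 0" by (metis atLeastAtMost_iff greaterThanLessThan_iff less_irrefl order_le_less)
      moreover have "(g \<longlongrightarrow> g x) (at x within {a..a + pi})"
        using contg x by (metis continuous_on)
      ultimately show ?thesis
        unfolding G_def cot_def by (intro tendsto_intros)
    qed
  qed
  have derG: "(G has_vector_derivative G' t) (at t)" if t: "t \<in> {a<..<a + pi}" for t
  proof -
    have "at t within {a..a + pi} = at t"
      using t by (intro at_within_Icc_at) auto
    then have *: "(g has_real_derivative g' t) (at t)" using g[of t] t by auto
    have "1 + (cot (t - a))\<^sup>2 = inverse ((sin (t - a))\<^sup>2)"
      using sin_pos[OF t] sin_cos_squared_add[of "t - a"]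
      by (simp add: cot_def power_divide field_simps)
    moreover have "((\<lambda>t. cot (t - a)) has_real_derivative - inverse ((sin (t - a))\<^sup>2) * 1) (at t)"
    proof (rule DERIV_chain2[where f = cot])
      show "(cot has_real_derivative - inverse ((sin (t - a))\<^sup>2)) (at (t - a))"
        using sin_pos[OF t] by (intro DERIV_cot) auto
      show "((\<lambda>t. t - a) has_real_derivative 1) (at t)"
        by (intro derivative_eq_intros) auto
    qed
    ultimately have cot': "((\<lambda>t. cot (t - a)) has_real_derivative - (1 + (cot (t - a))\<^sup>2)) (at t)"
      by simp
    have "(G has_real_derivative G' t) (at t)"
      unfolding G_def[abs_def]
      by (rule DERIV_cong[OF DERIV_mult'[OF DERIV_power[OF *, of 2] cot']]) (simp add: G'_def algebra_simps)
    then show ?thesis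
      by (simp add: has_real_derivative_iff_has_vector_derivative)
  qed
  have "(G' has_integral (G (a + pi) - G a)) {a..a + pi}"
    by (rule fundamental_theorem_of_calculus_interior) (auto intro: contG derG)
  then have G': "(G' has_integral 0) {a..a + pi}" using zero by (simp add: G_def)
  have i1: "(\<lambda>t. (g t)\<^sup>2) integrable_on {a..a + pi}" and i2: "(\<lambda>t. (g' t)\<^sup>2) integrable_on {a..a + pi}"
    by (auto intro!: integrable_continuous_interval continuous_intros contg cont)
  have "0 \<le> integral {a..a + pi} (\<lambda>t. (g' t)\<^sup>2 - (g t)\<^sup>2)"
  proof (rule has_integral_le[OF G'])
    show "((\<lambda>t. (g' t)\<^sup>2 - (g t)\<^sup>2) has_integral integral {a..a + pi} (\<lambda>t. (g' t)\<^sup>2 - (g t)\<^sup>2)) {a..a + pi}"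
      using i1 i2 by (intro integrable_integral integrable_diff)
  next
    fix t
    have "(g' t)\<^sup>2 - (g t)\<^sup>2 - G' t = (g' t - g t * cot (t - a))\<^sup>2"
      by (simp add: G'_def power2_eq_square algebra_simps)
    then show "G' t \<le> (g' t)\<^sup>2 - (g t)\<^sup>2"
      by (metis diff_ge_0_iff_ge zero_le_power2)
  qed
  then show ?thesis using i1 i2 by (simp add: integral_diff)
qed

text \<open>The function \<open>t \<mapsto> g(t + \<pi>) - g(t)\<close> changes sign over half a period, so \<open>g\<close> takes the same value
  \<open>c\<close> at two opposite points \<open>a\<close> and \<open>a + \<pi>\<close>. The Dirichlet case applies to \<open>g - c\<close> on both of the
  half periods that they bound. This avoids Fourier series and the normalization of the mean.\<close>

lemma wirtinger_periodic:
  fixes g g' :: "real \<Rightarrow> real"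
  assumes g: "\<And>t. (g has_real_derivative g' t) (at t)"
    and cont: "continuous_on UNIV g'"
    and per: "\<And>t. g (t + 2 * pi) = g t" "\<And>t. g' (t + 2 * pi) = g' t"
  obtains c where "integral {0..2*pi} (\<lambda>t. (g t - c)\<^sup>2) \<le> integral {0..2*pi} (\<lambda>t. (g' t)\<^sup>2)"
proof -
  have contg: "continuous_on A g" for A
    using g by (meson DERIV_isCont continuous_at_imp_continuous_on)
  have cont': "continuous_on A g'" for A
    using cont continuous_on_subset by blast
  define d where "d t = g (t + pi) - g t" for t
  have dpi: "d pi = - d 0"
    using per(1)[of 0] by (simp add: d_def)
  have contd: "continuous_on {0..pi} d"
    unfolding d_def by (intro continuous_intros continuous_on_compose2[OF contg[of UNIV]]) auto
  have "\<exists>a. 0 \<le> a \<and> a \<le> pi \<and> d a = 0"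
  proof (cases "d 0 \<le> 0")
    case True
    then show ?thesis using IVT'[of d 0 0 pi] contd dpi by auto
  next
    case False
    then show ?thesis using IVT2'[of d pi 0 0] contd dpi by auto
  qed
  then obtain a where a: "0 \<le> a" "a \<le> pi" "g (a + pi) = g a" by (auto simp: d_def)
  define c where "c = g a"
  have shift: "integral {0..2*pi} h = integral {a..a + 2*pi} h"
    if h: "continuous_on UNIV h" "\<And>t. h (t + 2 * pi) = h t" for h :: "real \<Rightarrow> real"
  proof -
    have ch: "continuous_on A h" for A using h(1) continuous_on_subset by blast
    have i: "h integrable_on {x..y}" for x y by (intro integrable_continuous_interval ch)
    have "integral {2*pi..a + 2*pi} h = integral {0..a} (\<lambda>t. h (t + 2*pi))"
      using integral_shift_real_ivl[of "2*pi" "2*pi" "a + 2*pi" h] by simp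
    also have "\<dots> = integral {0..a} h" using h(2) by simp
    finally have 1: "integral {2*pi..a + 2*pi} h = integral {0..a} h" .
    have "integral {0..a} h + integral {a..2*pi} h = integral {0..2*pi} h"
      using a by (intro Henstock_Kurzweil_Integration.integral_combine i) auto
    moreover have "integral {a..2*pi} h + integral {2*pi..a + 2*pi} h = integral {a..a+2*pi} h"
      using a by (intro Henstock_Kurzweil_Integration.integral_combine i) auto
    ultimately show ?thesis using 1 by simp
  qed
  have half: "integral {b..b + pi} (\<lambda>t. (g t - c)\<^sup>2) \<le> integral {b..b + pi} (\<lambda>t. (g' t)\<^sup>2)"
    if b: "g b = c" "g (b + pi) = c" for b
    using b by (intro wirtinger_dirichlet cont')
      (auto intro!: derivative_eq_intros DERIV_subset[OF g])
  have split: "integral {a..a + 2*pi} h = integral {a..a+pi} h + integral {a+pi..a+pi+pi} h"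
    if h: "continuous_on UNIV h" for h :: "real \<Rightarrow> real"
  proof -
    have ch: "continuous_on A h" for A using h(1) continuous_on_subset by blast
    have "integral {a..a+pi} h + integral {a+pi..a+2*pi} h = integral {a..a+2*pi} h"
      by (intro Henstock_Kurzweil_Integration.integral_combine integrable_continuous_interval ch) auto
    then show ?thesis by (simp add: algebra_simps)
  qed
  have c1: "continuous_on UNIV (\<lambda>t. (g t - c)\<^sup>2)" and c2: "continuous_on UNIV (\<lambda>t. (g' t)\<^sup>2)"
    by (intro continuous_intros contg cont')+
  have "integral {0..2*pi} (\<lambda>t. (g t - c)\<^sup>2) = integral {a..a+pi} (\<lambda>t. (g t - c)\<^sup>2) + integral {a+pi..a+pi+pi} (\<lambda>t. (g t - c)\<^sup>2)"
    using shift[OF c1] split[OF c1] per by simp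
  also have "\<dots> \<le> integral {a..a+pi} (\<lambda>t. (g' t)\<^sup>2) + integral {a+pi..a+pi+pi} (\<lambda>t. (g' t)\<^sup>2)"
    using a per(1)[of a] by (intro add_mono half) (auto simp: c_def algebra_simps)
  also have "\<dots> = integral {0..2*pi} (\<lambda>t. (g' t)\<^sup>2)"
    using shift[OF c2] split[OF c2] per by simp
  finally show ?thesis using that by blast
qed

text \<open>The integral on the left is twice the signed area enclosed by the curve \<open>Y\<close>, which does not
  change if \<open>Y\<close> is translated. After a suitable translation of both coordinates the arithmetic-geometric
  mean inequality and the Wirtinger inequality give the bound (Hurwitz).\<close>

lemma planar_isoperimetric:
  fixes Y Y' :: "real \<Rightarrow> complex"
  assumes Y: "\<And>t. (Y has_vector_derivative Y' t) (at t)"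
    and cont: "continuous_on UNIV Y'"
    and per: "\<And>t. Y (t + 2 * pi) = Y t" "\<And>t. Y' (t + 2 * pi) = Y' t"
  shows "\<bar>integral {0..2*pi} (\<lambda>t. Im (cnj (Y t) * Y' t))\<bar> \<le> integral {0..2*pi} (\<lambda>t. (cmod (Y' t))\<^sup>2)"
proof -
  have dR: "((\<lambda>t. Re (Y t)) has_real_derivative Re (Y' t)) (at t)" for t
    using bounded_linear.has_vector_derivative[OF bounded_linear_Re Y] by (simp add: has_real_derivative_iff_has_vector_derivative)
  have dI: "((\<lambda>t. Im (Y t)) has_real_derivative Im (Y' t)) (at t)" for t
    using bounded_linear.has_vector_derivative[OF bounded_linear_Im Y] by (simp add: has_real_derivative_iff_has_vector_derivative)
  have contY: "continuous_on A Y" for A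
    using Y by (meson continuous_at_imp_continuous_on has_vector_derivative_continuous)
  have cont': "continuous_on A Y'" for A
    using cont continuous_on_subset by blast
  obtain p where p: "integral {0..2*pi} (\<lambda>t. (Re (Y t) - p)\<^sup>2) \<le> integral {0..2*pi} (\<lambda>t. (Re (Y' t))\<^sup>2)"
    by (rule wirtinger_periodic[OF dR]) (use per in \<open>auto intro!: continuous_intros cont'\<close>)
  obtain q where q: "integral {0..2*pi} (\<lambda>t. (Im (Y t) - q)\<^sup>2) \<le> integral {0..2*pi} (\<lambda>t. (Im (Y' t))\<^sup>2)"
    by (rule wirtinger_periodic[OF dI]) (use per in \<open>auto intro!: continuous_intros cont'\<close>)
  note ii = integrable_integral integrable_continuous_interval continuous_intros contY cont'
  have zero: "(Y' has_integral 0) {0..2*pi}"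
    using fundamental_theorem_of_calculus[of 0 "2*pi" Y Y'] has_vector_derivative_at_within[OF Y] per(1)[of 0]
    by auto
  have zR: "integral {0..2*pi} (\<lambda>t. Re (Y' t)) = 0"
    using has_integral_linear[OF zero bounded_linear_Re] by (auto simp: o_def)
  have zI: "integral {0..2*pi} (\<lambda>t. Im (Y' t)) = 0"
    using has_integral_linear[OF zero bounded_linear_Im] by (auto simp: o_def)
  define W where "W t = (Re (Y t) - p) * Im (Y' t) - (Im (Y t) - q) * Re (Y' t)" for t
  have W: "integral {0..2*pi} (\<lambda>t. Im (cnj (Y t) * Y' t)) = integral {0..2*pi} W"
  proof -
    have "integral {0..2*pi} W = integral {0..2*pi} (\<lambda>t. Im (cnj (Y t) * Y' t) - p * Im (Y' t) + q * Re (Y' t))"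
      by (rule Henstock_Kurzweil_Integration.integral_cong) (simp add: W_def algebra_simps)
    also have "\<dots> = integral {0..2*pi} (\<lambda>t. Im (cnj (Y t) * Y' t)) - p * integral {0..2*pi} (\<lambda>t. Im (Y' t))
        + q * integral {0..2*pi} (\<lambda>t. Re (Y' t))"
      by (intro integral_unique has_integral_add has_integral_diff has_integral_mult_right ii)
    finally show ?thesis using zR zI by simp
  qed
  define V where "V t = ((Re (Y t) - p)\<^sup>2 + (Im (Y' t))\<^sup>2 + (Im (Y t) - q)\<^sup>2 + (Re (Y' t))\<^sup>2) / 2" for t
  have WV: "\<bar>W t\<bar> \<le> V t" for t
  proof -
    have 1: "\<bar>x * y - u * v\<bar> \<le> (x\<^sup>2 + y\<^sup>2 + u\<^sup>2 + v\<^sup>2) / 2" for x y u v :: real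
      using sum_squares_bound[of "\<bar>x\<bar>" "\<bar>y\<bar>"] sum_squares_bound[of "\<bar>u\<bar>" "\<bar>v\<bar>"]
        abs_triangle_ineq4[of "x * y" "u * v"] by (simp add: abs_mult)
    show ?thesis unfolding W_def V_def by (rule 1)
  qed
  have "\<bar>integral {0..2*pi} W\<bar> \<le> integral {0..2*pi} V"
  proof (rule integral_norm_bound_integral[where f = W, unfolded real_norm_def])
    show "W integrable_on {0..2*pi}" "V integrable_on {0..2*pi}"
      unfolding W_def[abs_def] V_def[abs_def] by (auto intro!: ii(2-))
  qed (rule WV)
  also have "\<dots> = (integral {0..2*pi} (\<lambda>t. (Re (Y t) - p)\<^sup>2) + integral {0..2*pi} (\<lambda>t. (Im (Y' t))\<^sup>2)
      + integral {0..2*pi} (\<lambda>t. (Im (Y t) - q)\<^sup>2) + integral {0..2*pi} (\<lambda>t. (Re (Y' t))\<^sup>2)) / 2"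
    unfolding V_def by (intro integral_unique has_integral_divide has_integral_add ii)
  also have "\<dots> \<le> integral {0..2*pi} (\<lambda>t. (Re (Y' t))\<^sup>2) + integral {0..2*pi} (\<lambda>t. (Im (Y' t))\<^sup>2)"
    using p q by simp
  also have "\<dots> = integral {0..2*pi} (\<lambda>t. (cmod (Y' t))\<^sup>2)"
    unfolding cmod_power2 by (intro integral_unique[symmetric] has_integral_add ii)
  finally show ?thesis using W by simp
qed

section \<open>Integration in polar coordinates\<close>

text \<open>Such a map is an isometry that sends boxes to boxes. It serves to identify the Lebesgue
  measures of \<open>real^2\<close>, where the change of variables formula lives, of the complex plane, and of
  \<open>real \<times> real\<close>, where Fubini's theorem lives.\<close>

lemma lborel_distr_basis_isometry:
  fixes T :: "'a::euclidean_space \<Rightarrow> 'b::euclidean_space"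
  assumes T: "linear T" and bij: "bij_betw T Basis Basis"
    and inner: "\<And>x c. c \<in> Basis \<Longrightarrow> T x \<bullet> T c = x \<bullet> c"
  shows "distr lborel borel T = lborel"
proof (rule lborel_eqI[symmetric])
  have meas: "T \<in> borel_measurable borel"
    using T by (intro borel_measurable_continuous_onI linear_continuous_on) (simp add: linear_conv_bounded_linear)
  have img: "T ` Basis = Basis" using bij by (simp add: bij_betw_def)
  fix l u :: 'b
  assume lu: "\<And>b. b \<in> Basis \<Longrightarrow> l \<bullet> b \<le> u \<bullet> b"
  define p where "p v = (\<Sum>c\<in>Basis. (v \<bullet> T c) *\<^sub>R c)" for v :: 'b
  have p: "p v \<bullet> c = v \<bullet> T c" if "c \<in> Basis" for v c
    using that by (simp add: p_def)
  have "T -` box l u = box (p l) (p u)"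
  proof (intro set_eqI)
    fix x
    have "x \<in> T -` box l u \<longleftrightarrow> (\<forall>b\<in>T ` Basis. l \<bullet> b < T x \<bullet> b \<and> T x \<bullet> b < u \<bullet> b)"
      by (simp add: img mem_box)
    also have "\<dots> \<longleftrightarrow> x \<in> box (p l) (p u)"
      by (simp add: mem_box p inner)
    finally show "x \<in> T -` box l u \<longleftrightarrow> x \<in> box (p l) (p u)" .
  qed
  moreover have "p l \<bullet> c \<le> p u \<bullet> c" if "c \<in> Basis" for c
    using that img lu by (auto simp: p)
  ultimately have "emeasure (distr lborel borel T) (box l u) = (\<Prod>c\<in>Basis. (p u - p l) \<bullet> c)"
    using meas by (simp add: emeasure_distr emeasure_lborel_box)
  also have "(\<Prod>c\<in>Basis. (p u - p l) \<bullet> c) = (\<Prod>c\<in>Basis. (u - l) \<bullet> T c)"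
    by (rule prod.cong) (auto simp: p inner_diff_left)
  also have "\<dots> = (\<Prod>b\<in>Basis. (u - l) \<bullet> b)"
    by (rule prod.reindex_bij_betw[OF bij])
  finally show "emeasure (distr lborel borel T) (box l u) = (\<Prod>b\<in>Basis. (u - l) \<bullet> b)" .
qed simp

lemma Basis_real_2: "(Basis :: (real^2) set) = {axis 1 1, axis 2 1}"
  by (auto simp: Basis_vec_def UNIV_2)

lemma axis_1_neq_axis_2: "axis 1 (1::real) \<noteq> (axis 2 1 :: real^2)"
  by (simp add: axis_eq_axis)

lemma lborel_complex_eq_distr: "distr lborel borel (\<lambda>x :: real^2. Complex (x $ 1) (x $ 2)) = lborel"
proof (rule lborel_distr_basis_isometry)
  show "linear (\<lambda>x :: real^2. Complex (x $ 1) (x $ 2))"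
    by (auto intro!: linearI simp: complex_eq_iff)
  show "bij_betw (\<lambda>x :: real^2. Complex (x $ 1) (x $ 2)) Basis Basis"
    using axis_1_neq_axis_2
    by (auto simp: bij_betw_def Basis_real_2 Basis_complex_def complex_eq_iff axis_def inj_on_def)
qed (auto simp: Basis_real_2 inner_axis inner_complex_def, auto simp: axis_def)

lemma lborel_pair_eq_distr: "distr lborel borel (\<lambda>x :: real^2. (x $ 1, x $ 2)) = lborel"
proof (rule lborel_distr_basis_isometry)
  show "linear (\<lambda>x :: real^2. (x $ 1, x $ 2))"
    by (auto intro!: linearI)
  show "bij_betw (\<lambda>x :: real^2. (x $ 1, x $ 2)) Basis Basis"
    using axis_1_neq_axis_2
    by (auto simp: bij_betw_def Basis_real_2 Basis_prod_def axis_def inj_on_def)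
qed (auto simp: Basis_real_2 inner_axis, auto simp: axis_def)

lemma set_integral_distr_lborel:
  fixes T :: "'a::euclidean_space \<Rightarrow> 'b::euclidean_space" and h :: "'b \<Rightarrow> real"
  assumes distr: "distr lborel borel T = lborel" and T: "T \<in> borel_measurable borel"
    and h: "set_integrable lborel A h"
  shows "set_integrable lborel (T -` A) (\<lambda>x. h (T x))"
    and "integral (T -` A) (\<lambda>x. h (T x)) = integral A h"
proof -
  have h': "integrable (distr lborel borel T) (\<lambda>z. indicator A z *\<^sub>R h z)"
    using h by (simp add: distr set_integrable_def)
  have m: "(\<lambda>z. indicator A z *\<^sub>R h z) \<in> borel_measurable borel"
    using borel_measurable_integrable[OF h'] by simp
  have i: "integrable lborel (\<lambda>x. indicator A (T x) *\<^sub>R h (T x))"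
    using integrable_distr[OF _ h'] T by simp
  show *: "set_integrable lborel (T -` A) (\<lambda>x. h (T x))"
    using i unfolding set_integrable_def by (simp add: indicator_def vimage_def)
  have "(LINT z:A|lborel. h z) = (LINT x|lborel. indicator A (T x) *\<^sub>R h (T x))"
    unfolding set_lebesgue_integral_def
    using integral_distr[of T lborel borel, OF _ m] T by (simp add: distr)
  also have "\<dots> = (LINT x:T -` A|lborel. h (T x))"
    unfolding set_lebesgue_integral_def by (simp add: indicator_def vimage_def)
  finally show "integral (T -` A) (\<lambda>x. h (T x)) = integral A h"
    using set_borel_integral_eq_integral(2)[OF h] set_borel_integral_eq_integral(2)[OF *] by simp
qed

lemma inj_on_polar: "inj_on (\<lambda>x :: real^2. vector [x $ 1 * cos (x $ 2), x $ 1 * sin (x $ 2)] :: real^2)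
    {x. 0 < x $ 1 \<and> 0 < x $ 2 \<and> x $ 2 < 2 * pi}"
proof (rule inj_onI, clarsimp simp: vec_eq_iff forall_2)
  fix x y :: "real^2"
  assume x: "0 < x $ 1" "0 < x $ 2" "x $ 2 < 2 * pi" and y: "0 < y $ 1" "0 < y $ 2" "y $ 2 < 2 * pi"
    and c: "x $ 1 * cos (x $ 2) = y $ 1 * cos (y $ 2)" and s: "x $ 1 * sin (x $ 2) = y $ 1 * sin (y $ 2)"
  have eq: "complex_of_real (x $ 1) * cis (x $ 2) = complex_of_real (y $ 1) * cis (y $ 2)"
    using c s by (simp add: complex_eq_iff)
  then have "cmod (complex_of_real (x $ 1) * cis (x $ 2)) = cmod (complex_of_real (y $ 1) * cis (y $ 2))"
    by simp
  then have 1: "x $ 1 = y $ 1" using x y by (simp add: norm_mult)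
  with eq x have "cis (x $ 2) = cis (y $ 2)" by simp
  then have "x $ 2 = y $ 2"
    using Arg2pi_unique[of 1 "x $ 2" "cis (x $ 2)"] Arg2pi_unique[of 1 "y $ 2" "cis (y $ 2)"] x y
    by (simp add: cis_conv_exp mult.commute)
  with 1 show "x $ 1 = y $ 1 \<and> x $ 2 = y $ 2" by simp
qed

text \<open>Polar coordinates map the open rectangle \<open>(0,r) \<times> (0,2\<pi>)\<close> bijectively onto the disk without a
  radius, which is a null set, and have the Jacobian \<open>\<rho>\<close>.\<close>

lemma polar_integral:
  fixes h :: "complex \<Rightarrow> real"
  assumes r: "0 < r" and h: "continuous_on (cball 0 r) h"
  shows "(LINT z:ball 0 r|lebesgue. h z) =
    integral {0..r} (\<lambda>\<rho>. \<rho> * integral {0..2*pi} (\<lambda>\<theta>. h (\<rho> * cis \<theta>)))"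
proof -
  define T where "T = (\<lambda>x :: real^2. Complex (x $ 1) (x $ 2))"
  define U where "U = (\<lambda>x :: real^2. (x $ 1, x $ 2))"
  define \<Phi> where "\<Phi> = (\<lambda>x :: real^2. vector [x $ 1 * cos (x $ 2), x $ 1 * sin (x $ 2)] :: real^2)"
  define S where "S = {x :: real^2. 0 < x $ 1 \<and> x $ 1 < r \<and> 0 < x $ 2 \<and> x $ 2 < 2 * pi}"
  define k where "k = (\<lambda>p :: real \<times> real. fst p * h (complex_of_real (fst p) * cis (snd p)))"
  have T_meas: "T \<in> borel_measurable borel" and U_meas: "U \<in> borel_measurable borel"
    unfolding T_def U_def Complex_eq
    by (intro borel_measurable_continuous_onI continuous_intros)+
  have T\<Phi>: "T (\<Phi> x) = x $ 1 * cis (x $ 2)" for x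
    by (simp add: T_def \<Phi>_def complex_eq_iff)
  have S_box: "S = box (vector [0, 0]) (vector [r, 2 * pi])"
    by (auto simp: S_def mem_box_cart forall_2)
  have S_U: "S = U -` box (0, 0) (r, 2 * pi)"
    by (auto simp: S_def U_def box_prod)
  have k_cont: "continuous_on (cbox (0, 0) (r, 2 * pi)) k"
  proof -
    have "continuous_on (cbox (0, 0) (r, 2 * pi)) (\<lambda>p. h (complex_of_real (fst p) * cis (snd p)))"
    proof (rule continuous_on_compose2[OF h])
      show "continuous_on (cbox (0, 0) (r, 2 * pi)) (\<lambda>p. complex_of_real (fst p) * cis (snd p))"
        by (intro continuous_intros)
    qed (auto simp: norm_mult cbox_Pair_eq)
    then show ?thesis unfolding k_def by (intro continuous_intros)
  qed
  have "set_integrable lborel (cbox (0, 0) (r, 2 * pi)) k"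
    unfolding set_integrable_def by (intro borel_integrable_compact k_cont) auto
  then have k_int: "set_integrable lborel (box (0, 0) (r, 2 * pi)) k"
    by (rule set_integrable_subset) (auto simp: box_subset_cbox)
  have ib: "set_integrable lborel (cball 0 r) h"
    unfolding set_integrable_def by (intro borel_integrable_compact h) auto
  then have ib: "set_integrable lborel (ball 0 r) h"
    by (rule set_integrable_subset) auto
  have il: "set_integrable lebesgue (ball 0 r) h"
    using ib unfolding set_integrable_def by (subst integrable_completion) auto
  have "(LINT z:ball 0 r|lebesgue. h z) = integral (ball 0 r) h"
    by (rule set_lebesgue_integral_eq_integral(2)[OF il])
  also have "\<dots> = integral (T -` ball 0 r) (\<lambda>x. h (T x))"
    using set_integral_distr_lborel(2)[OF _ T_meas ib] lborel_complex_eq_distr by (simp add: T_def)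
  also have "\<dots> = integral (\<Phi> ` S) (\<lambda>x. h (T x))"
  proof (rule integral_spike_set)
    have sub: "\<Phi> ` S \<subseteq> T -` ball 0 r"
      using T\<Phi> by (auto simp: S_def norm_mult)
    \<comment> \<open>The image misses only points of the real axis, where the argument can be \<open>0\<close>.\<close>
    have "T -` ball 0 r - \<Phi> ` S \<subseteq> {x :: real^2. x $ 2 = 0}"
    proof (rule subsetI, rule ccontr)
      fix x :: "real^2" assume x: "x \<in> T -` ball 0 r - \<Phi> ` S" and "x \<notin> {x :: real^2. x $ 2 = 0}"
      then have x2: "x $ 2 \<noteq> 0" by simp
      define y :: "real^2" where "y = vector [cmod (T x), Arg2pi (T x)]"
      have Tx: "T x \<noteq> 0" "Im (T x) \<noteq> 0" using x2 by (auto simp: T_def complex_eq_iff)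
      have "Arg2pi (T x) \<noteq> 0"
        using Tx by (metis Arg2pi_eq_0 complex_is_Real_iff)
      then have "y \<in> S" using x Tx Arg2pi[of "T x"] by (auto simp: y_def S_def order.strict_iff_order)
      moreover have "T (\<Phi> y) = T x"
        using Arg2pi_eq[of "T x"] by (simp add: T\<Phi> y_def cis_conv_exp)
      then have "\<Phi> y = x" by (simp add: T_def vec_eq_iff forall_2)
      ultimately show False using x by auto
    qed
    then have "negligible (T -` ball 0 r - \<Phi> ` S)"
      using negligible_subset negligible_standard_hyperplane_cart by blast
    then show "negligible {x \<in> T -` ball 0 r - \<Phi> ` S. h (T x) \<noteq> 0}"
      by (rule negligible_subset) auto
    show "negligible {x \<in> \<Phi> ` S - T -` ball 0 r. h (T x) \<noteq> 0}"
    proof -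
      have empty: "{x \<in> \<Phi> ` S - T -` ball 0 r. h (T x) \<noteq> 0} = {}" using sub by blast
      show ?thesis unfolding empty by (rule negligible_empty)
    qed
  qed
  also have "\<dots> = integral S (\<lambda>x. x $ 1 * h (T (\<Phi> x)))"
  proof -
    define D where "D x v = (vector [v $ 1 * cos (x $ 2) - x $ 1 * v $ 2 * sin (x $ 2),
      v $ 1 * sin (x $ 2) + x $ 1 * v $ 2 * cos (x $ 2)] :: real^2)" for x v :: "real^2"
    have coord: "((\<lambda>x :: real^2. x $ i) has_derivative (\<lambda>v. v $ i)) (at x within S)" for i x
      by (rule bounded_linear.has_derivative[OF bounded_linear_vec_nth has_derivative_ident])
    have der: "(\<Phi> has_derivative D x) (at x within S)" for x
      unfolding has_derivative_componentwise_within[of \<Phi>] Basis_real_2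
      by (auto simp: \<Phi>_def D_def inner_axis intro!: derivative_eq_intros coord)
    have det: "det (matrix (D x)) = x $ 1" for x
    proof -
      have "det (matrix (D x)) = x $ 1 * cos (x $ 2) * cos (x $ 2) + x $ 1 * sin (x $ 2) * sin (x $ 2)"
        by (simp add: det_2 matrix_def D_def axis_def)
      also have "\<dots> = x $ 1 * ((cos (x $ 2))\<^sup>2 + (sin (x $ 2))\<^sup>2)"
        by (simp only: power2_eq_square distrib_left mult.assoc)
      finally show ?thesis by simp
    qed
    have inj: "inj_on \<Phi> S"
      unfolding \<Phi>_def by (rule inj_on_subset[OF inj_on_polar]) (auto simp: S_def)
    define f :: "real^2 \<Rightarrow> real^1" where "f x = vec (h (T x))" for x
    have S: "S \<in> sets lebesgue" unfolding S_box by simp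
    have "set_integrable lborel S (\<lambda>x. k (U x))"
      unfolding S_U by (rule set_integral_distr_lborel(1)[OF _ U_meas k_int]) 
        (use lborel_pair_eq_distr in \<open>simp add: U_def\<close>)
    then have kU: "(\<lambda>x. k (U x)) absolutely_integrable_on S"
      unfolding set_integrable_def by (subst integrable_completion) auto
    have "(\<lambda>x. \<bar>det (matrix (D x))\<bar> *\<^sub>R f (\<Phi> x)) absolutely_integrable_on S"
    proof (subst absolutely_integrable_componentwise_iff, rule ballI)
      fix b :: "real^1" assume "b \<in> Basis"
      then have b: "b = axis 1 1" by (auto simp: Basis_vec_def)
      show "(\<lambda>x. (\<bar>det (matrix (D x))\<bar> *\<^sub>R f (\<Phi> x)) \<bullet> b) absolutely_integrable_on S"
        by (rule set_integrable_cong[THEN iffD1, OF refl refl _ kU])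
          (auto simp: det f_def b inner_axis k_def U_def T\<Phi> S_def)
    qed
    then have cov: "f absolutely_integrable_on \<Phi> ` S"
      "integral (\<Phi> ` S) f = integral S (\<lambda>x. \<bar>det (matrix (D x))\<bar> *\<^sub>R f (\<Phi> x))"
      "(\<lambda>x. \<bar>det (matrix (D x))\<bar> *\<^sub>R f (\<Phi> x)) absolutely_integrable_on S"
      using has_absolute_integral_change_of_variables[OF S der inj, of f] by blast+
    have "integral (\<Phi> ` S) (\<lambda>x. h (T x)) = integral (\<Phi> ` S) f \<bullet> axis 1 1"
      using cov(1) by (subst integral_component_eq[symmetric]) 
        (auto simp: f_def inner_axis intro: set_lebesgue_integral_eq_integral(1))
    also have "\<dots> = integral S (\<lambda>x. \<bar>x $ 1\<bar> * h (T (\<Phi> x)))"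
      using cov(3) by (subst cov(2), subst integral_component_eq[symmetric]) 
        (auto simp: f_def det inner_axis intro: set_lebesgue_integral_eq_integral(1))
    also have "\<dots> = integral S (\<lambda>x. x $ 1 * h (T (\<Phi> x)))"
      by (rule Henstock_Kurzweil_Integration.integral_cong) (auto simp: S_def)
    finally show ?thesis .
  qed
  also have "\<dots> = integral (U -` box (0, 0) (r, 2 * pi)) (\<lambda>x. k (U x))"
    by (simp add: S_U k_def U_def T\<Phi>)
  also have "\<dots> = integral (box (0, 0) (r, 2 * pi)) k"
    by (rule set_integral_distr_lborel(2)[OF _ U_meas k_int]) (use lborel_pair_eq_distr in \<open>simp add: U_def\<close>)
  also have "\<dots> = integral (cbox (0, 0) (r, 2 * pi)) k"
    by (rule integral_open_interval)
  also have "\<dots> = integral {0..r} (\<lambda>\<rho>. integral {0..2*pi} (\<lambda>\<theta>. k (\<rho>, \<theta>)))"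
    using integral_prod_continuous[OF k_cont] by simp
  also have "\<dots> = integral {0..r} (\<lambda>\<rho>. \<rho> * integral {0..2*pi} (\<lambda>\<theta>. h (\<rho> * cis \<theta>)))"
    by (simp add: k_def)
  finally show ?thesis .
qed

section \<open>Spherical area of holomorphic functions on the disk\<close>

lemma polar_point_in_ball: "\<bar>\<rho>\<bar> < 1 \<Longrightarrow> complex_of_real \<rho> * cis \<theta> \<in> ball 0 1"
  by (simp add: norm_mult)

lemma has_vector_derivative_radial:
  fixes \<rho> :: real
  assumes "f holomorphic_on ball 0 1" "\<bar>\<rho>\<bar> < 1"
  shows "((\<lambda>\<rho>. f (\<rho> * cis \<theta>)) has_vector_derivative deriv f (\<rho> * cis \<theta>) * cis \<theta>) (at \<rho>)"
proof -
  have f: "(f has_field_derivative deriv f (\<rho> * cis \<theta>)) (at (\<rho> * cis \<theta>))"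
    by (rule holomorphic_derivI[OF assms(1)]) (use polar_point_in_ball assms in auto)
  have "((\<lambda>\<rho>. complex_of_real \<rho> * cis \<theta>) has_vector_derivative cis \<theta>) (at \<rho>)"
    by (rule has_vector_derivative_eq_rhs[OF has_vector_derivative_mult_left[OF has_vector_derivative_of_real[OF DERIV_ident]]]) simp
  from field_vector_diff_chain_at[OF this f] show ?thesis
    by (simp add: o_def mult.commute)
qed

lemma has_vector_derivative_cis_self: "(cis has_vector_derivative \<i> * cis \<theta>) (at \<theta>)"
proof -
  have "((\<lambda>t. exp (\<i> * complex_of_real t)) has_vector_derivative \<i> * exp (\<i> * complex_of_real \<theta>)) (at \<theta>)"
    by (rule has_vector_derivative_real_field, auto intro!: derivative_eq_intros)
  then show ?thesis by (simp add: cis_conv_exp[abs_def])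
qed

lemma has_vector_derivative_angular:
  fixes \<rho> :: real
  assumes "f holomorphic_on ball 0 1" "\<bar>\<rho>\<bar> < 1"
  shows "((\<lambda>\<theta>. f (\<rho> * cis \<theta>)) has_vector_derivative deriv f (\<rho> * cis \<theta>) * (\<i> * \<rho> * cis \<theta>)) (at \<theta>)"
proof -
  have f: "(f has_field_derivative deriv f (\<rho> * cis \<theta>)) (at (\<rho> * cis \<theta>))"
    by (rule holomorphic_derivI[OF assms(1)]) (use polar_point_in_ball assms in auto)
  note has_vector_derivative_cis_self[of \<theta>]
  then have "((\<lambda>\<theta>. complex_of_real \<rho> * cis \<theta>) has_vector_derivative \<rho> * (\<i> * cis \<theta>)) (at \<theta>)"
    by (rule has_vector_derivative_mult_right)
  from field_vector_diff_chain_at[OF this f] show ?thesis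
    by (simp add: o_def mult_ac)
qed

lemma continuous_on_polar:
  assumes "f holomorphic_on ball 0 1"
  shows "continuous_on ({-1<..<1} \<times> A) (\<lambda>p. f (complex_of_real (fst p) * cis (snd p)))"
  by (rule continuous_on_compose2[OF holomorphic_on_imp_continuous_on[OF assms]])
    (auto intro!: continuous_intros simp: norm_mult)

definition sq_mod :: "(complex \<Rightarrow> complex) \<Rightarrow> real \<Rightarrow> real \<Rightarrow> real" where
  "sq_mod h \<rho> \<theta> = (cmod (h (\<rho> * cis \<theta>)))\<^sup>2"

text \<open>The gradient of \<open>|h|\<^sup>2\<close> in polar coordinates: the partial derivatives of \<open>|h(\<rho> e\<^sup>i\<^sup>\<theta>)|\<^sup>2\<close> are
  \<open>2 Re w\<close> in \<open>\<rho>\<close> and \<open>-2 \<rho> Im w\<close> in \<open>\<theta>\<close>, where \<open>w\<close> is the complex number defined here.\<close>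

definition half_grad :: "(complex \<Rightarrow> complex) \<Rightarrow> real \<Rightarrow> real \<Rightarrow> complex" where
  "half_grad h \<rho> \<theta> = cis \<theta> * deriv h (\<rho> * cis \<theta>) * cnj (h (\<rho> * cis \<theta>))"

definition sphere_density :: "(complex \<Rightarrow> complex) \<Rightarrow> complex \<Rightarrow> real" where
  "sphere_density h z = (cmod (deriv h z) / (1 + (cmod (h z))\<^sup>2))\<^sup>2"

text \<open>The outward flux of the gradient of \<open>\<phi> = log(1 + |h|\<^sup>2) / 4\<close> through the circle of radius \<open>\<rho>\<close>.
  The Laplacian of \<open>\<phi>\<close> is the density of the spherical area pulled back by \<open>h\<close>.\<close>

definition flux :: "(complex \<Rightarrow> complex) \<Rightarrow> real \<Rightarrow> real" where
  "flux h \<rho> = integral {0..2*pi} (\<lambda>\<theta>. \<rho> * Re (half_grad h \<rho> \<theta>) / (1 + sq_mod h \<rho> \<theta>)) / 2"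

text \<open>Up to the factor \<open>\<pi>\<close> this is the mean over the circle of radius \<open>\<rho>\<close> of \<open>(1 + x\<^sub>3) / 2\<close>, where
  \<open>x\<^sub>3\<close> is the vertical coordinate of the stereographic image of \<open>h\<close>.\<close>

definition height :: "(complex \<Rightarrow> complex) \<Rightarrow> real \<Rightarrow> real" where
  "height h \<rho> = integral {0..2*pi} (\<lambda>\<theta>. sq_mod h \<rho> \<theta> / (1 + sq_mod h \<rho> \<theta>)) / 2"

lemma one_plus_sq_mod_pos: "1 + sq_mod h \<rho> \<theta> > 0"
  by (simp add: sq_mod_def add_pos_nonneg)

lemma one_plus_sq_mod_neq_0 [simp]: "1 + sq_mod h \<rho> \<theta> \<noteq> 0"
  using one_plus_sq_mod_pos[of h \<rho> \<theta>] by linarith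

lemma cmod_half_grad_sq: "(Re (half_grad h \<rho> \<theta>))\<^sup>2 + (Im (half_grad h \<rho> \<theta>))\<^sup>2
    = (cmod (deriv h (\<rho> * cis \<theta>)))\<^sup>2 * sq_mod h \<rho> \<theta>"
  unfolding cmod_power2[symmetric] half_grad_def sq_mod_def by (simp add: norm_mult power_mult_distrib)

lemma sphere_density_polar: "sphere_density h (\<rho> * cis \<theta>) = (cmod (deriv h (\<rho> * cis \<theta>)))\<^sup>2 / (1 + sq_mod h \<rho> \<theta>)\<^sup>2"
  by (simp add: sphere_density_def sq_mod_def power_divide)

lemma real_derivative_Re:
  "(f has_vector_derivative D) F \<Longrightarrow> ((\<lambda>x. Re (f x)) has_real_derivative Re D) F"
  by (simp add: has_real_derivative_iff_has_vector_derivative bounded_linear.has_vector_derivative[OF bounded_linear_Re])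

lemma real_derivative_Im:
  "(f has_vector_derivative D) F \<Longrightarrow> ((\<lambda>x. Im (f x)) has_real_derivative Im D) F"
  by (simp add: has_real_derivative_iff_has_vector_derivative bounded_linear.has_vector_derivative[OF bounded_linear_Im])

lemma real_derivative_cmod_sq:
  assumes "(f has_vector_derivative D) (at x)"
  shows "((\<lambda>x. (cmod (f x))\<^sup>2) has_real_derivative 2 * Re (D * cnj (f x))) (at x)"
  unfolding cmod_power2
  by (rule DERIV_cong[OF DERIV_add[OF DERIV_power DERIV_power]], rule real_derivative_Re[OF assms], 
     rule real_derivative_Im[OF assms]) (simp add: algebra_simps)

lemma continuous_on_section:
  fixes k :: "real \<Rightarrow> real \<Rightarrow> 'a::topological_space"
  assumes "continuous_on ({-1<..<1} \<times> A) (\<lambda>p. k (fst p) (snd p))" "\<bar>\<rho>\<bar> < 1"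
  shows "continuous_on A (k \<rho>)"
proof -
  have "continuous_on A (\<lambda>\<theta>. k (fst (\<rho>, \<theta>)) (snd (\<rho>, \<theta>)))"
    by (rule continuous_on_compose2[OF assms(1)]) (use assms(2) in \<open>auto intro!: continuous_intros\<close>)
  then show ?thesis by simp
qed

text \<open>The part of the derivatives of \<open>half_grad\<close> that contains the second derivative of \<open>h\<close>. It
  cancels between the radial and the angular derivative.\<close>

definition second_order_term :: "(complex \<Rightarrow> complex) \<Rightarrow> real \<Rightarrow> real \<Rightarrow> real" where
  "second_order_term h \<rho> \<theta> = Re ((cis \<theta>)\<^sup>2 * deriv (deriv h) (\<rho> * cis \<theta>) * cnj (h (\<rho> * cis \<theta>)))"

lemma double_half: "(2 * pi) * (a / s) / 2 = pi * a / s" for a s :: real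
  by simp

context
  fixes h :: "complex \<Rightarrow> complex"
  assumes holo: "h holomorphic_on ball 0 1"
begin

lemma deriv_holo: "deriv h holomorphic_on ball 0 1"
  by (rule holomorphic_deriv[OF holo]) simp

lemma sq_mod_radial:
  assumes "\<bar>\<rho>\<bar> < 1"
  shows "((\<lambda>\<rho>. sq_mod h \<rho> \<theta>) has_real_derivative 2 * Re (half_grad h \<rho> \<theta>)) (at \<rho>)"
  using real_derivative_cmod_sq[OF has_vector_derivative_radial[OF holo assms]]
  by (simp add: sq_mod_def half_grad_def mult_ac)

lemma sq_mod_angular:
  assumes "\<bar>\<rho>\<bar> < 1"
  shows "(sq_mod h \<rho> has_real_derivative - 2 * \<rho> * Im (half_grad h \<rho> \<theta>)) (at \<theta>)"
  unfolding sq_mod_def[abs_def]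
  by (rule DERIV_cong[OF real_derivative_cmod_sq[OF has_vector_derivative_angular[OF holo assms]]])
    (simp add: half_grad_def algebra_simps)

lemma half_grad_radial:
  assumes "\<bar>\<rho>\<bar> < 1"
  shows "((\<lambda>\<rho>. Re (half_grad h \<rho> \<theta>)) has_real_derivative
    second_order_term h \<rho> \<theta> + (cmod (deriv h (\<rho> * cis \<theta>)))\<^sup>2) (at \<rho>)"
proof -
  let ?z = "complex_of_real \<rho> * cis \<theta>"
  have "((\<lambda>\<rho>. cis \<theta> * deriv h (\<rho> * cis \<theta>) * cnj (h (\<rho> * cis \<theta>))) has_vector_derivative
    cis \<theta> * deriv h ?z * cnj (deriv h ?z * cis \<theta>) + cis \<theta> * (deriv (deriv h) ?z * cis \<theta>) * cnj (h ?z)) (at \<rho>)"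
    by (intro has_vector_derivative_mult has_vector_derivative_mult_right has_vector_derivative_cnj
      has_vector_derivative_radial holo deriv_holo assms)
  note * = real_derivative_Re[OF this]
  have "cis \<theta> * deriv h ?z * cnj (deriv h ?z * cis \<theta>) = (deriv h ?z * cis \<theta>) * cnj (deriv h ?z * cis \<theta>)"
    by simp
  also have "\<dots> = of_real ((cmod (deriv h ?z))\<^sup>2)"
    by (subst complex_norm_square[symmetric]) (simp add: norm_mult)
  finally have e: "cis \<theta> * deriv h ?z * cnj (deriv h ?z * cis \<theta>) = of_real ((cmod (deriv h ?z))\<^sup>2)" .
  show ?thesis
    unfolding half_grad_def
    by (rule DERIV_cong[OF *]) (subst e, simp add: second_order_term_def power2_eq_square mult_ac)
qed

lemma half_grad_angular:
  assumes "\<bar>\<rho>\<bar> < 1"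
  shows "((\<lambda>\<theta>. Im (half_grad h \<rho> \<theta>)) has_real_derivative
    Re (half_grad h \<rho> \<theta>) + \<rho> * second_order_term h \<rho> \<theta> - \<rho> * (cmod (deriv h (\<rho> * cis \<theta>)))\<^sup>2) (at \<theta>)"
proof -
  let ?z = "complex_of_real \<rho> * cis \<theta>"
  note has_vector_derivative_cis_self[of \<theta>]
  then have "((\<lambda>\<theta>. cis \<theta> * deriv h (\<rho> * cis \<theta>) * cnj (h (\<rho> * cis \<theta>))) has_vector_derivative
    (cis \<theta> * deriv h ?z) * cnj (deriv h ?z * (\<i> * \<rho> * cis \<theta>)) + 
    (cis \<theta> * (deriv (deriv h) ?z * (\<i> * \<rho> * cis \<theta>)) + (\<i> * cis \<theta>) * deriv h ?z) * cnj (h ?z)) (at \<theta>)"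
    by (intro has_vector_derivative_mult has_vector_derivative_cnj
      has_vector_derivative_angular holo deriv_holo assms)
  note * = real_derivative_Im[OF this]
  have "(cis \<theta> * deriv h ?z) * cnj (deriv h ?z * (\<i> * \<rho> * cis \<theta>)) = 
     - \<i> * \<rho> * ((deriv h ?z * cis \<theta>) * cnj (deriv h ?z * cis \<theta>))"
    by simp
  also have "(deriv h ?z * cis \<theta>) * cnj (deriv h ?z * cis \<theta>) = of_real ((cmod (deriv h ?z))\<^sup>2)"
    by (subst complex_norm_square[symmetric]) (simp add: norm_mult)
  finally have e: "(cis \<theta> * deriv h ?z) * cnj (deriv h ?z * (\<i> * \<rho> * cis \<theta>)) = - \<i> * \<rho> * of_real ((cmod (deriv h ?z))\<^sup>2)" .
  have e2: "(cis \<theta> * (deriv (deriv h) ?z * (\<i> * \<rho> * cis \<theta>)) + (\<i> * cis \<theta>) * deriv h ?z) * cnj (h ?z)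
    = \<i> * (\<rho> * ((cis \<theta>)\<^sup>2 * deriv (deriv h) ?z * cnj (h ?z)) + half_grad h \<rho> \<theta>)"
    by (simp add: half_grad_def power2_eq_square algebra_simps)
  show ?thesis
    unfolding half_grad_def[abs_def]
    by (rule DERIV_cong[OF *]) (subst e, subst e2, simp add: second_order_term_def half_grad_def)
qed

lemma continuous_on_polar_fields:
  "continuous_on ({-1<..<1} \<times> A) (\<lambda>p. sq_mod h (fst p) (snd p))"
  "continuous_on ({-1<..<1} \<times> A) (\<lambda>p. half_grad h (fst p) (snd p))"
  "continuous_on ({-1<..<1} \<times> A) (\<lambda>p. second_order_term h (fst p) (snd p))"
  "continuous_on ({-1<..<1} \<times> A) (\<lambda>p. cmod (deriv h (complex_of_real (fst p) * cis (snd p))))"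
  unfolding sq_mod_def half_grad_def second_order_term_def
  by (intro continuous_intros continuous_on_polar holo deriv_holo holomorphic_deriv open_ball)+

lemma continuous_on_circle_fields:
  assumes "\<bar>\<rho>\<bar> < 1"
  shows "continuous_on A (sq_mod h \<rho>)" "continuous_on A (half_grad h \<rho>)" "continuous_on A (second_order_term h \<rho>)"
    "continuous_on A (\<lambda>\<theta>. cmod (deriv h (complex_of_real \<rho> * cis \<theta>)))"
  by (rule continuous_on_section[where \<rho> = \<rho>], rule continuous_on_polar_fields, rule assms)+

text \<open>The divergence theorem in differential form. The integrand \<open>q\<close> of \<open>2 flux\<close> satisfies
  \<open>q\<^sub>\<rho> = 2 \<rho> \<delta> + c\<^sub>\<theta>\<close> with the area density \<open>\<delta>\<close> and a periodic function \<open>c\<close>, whose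
  derivative integrates to \<open>0\<close> over the circle.\<close>

lemma flux_deriv:
  assumes \<rho>: "\<bar>\<rho>\<bar> < 1"
  shows "(flux h has_real_derivative \<rho> * integral {0..2*pi} (\<lambda>\<theta>. sphere_density h (\<rho> * cis \<theta>))) (at \<rho>)"
proof -
  define N where "N \<rho> \<theta> = (cmod (deriv h (complex_of_real \<rho> * cis \<theta>)))\<^sup>2" for \<rho> \<theta>
  define q where "q \<rho> \<theta> = \<rho> * Re (half_grad h \<rho> \<theta>) / (1 + sq_mod h \<rho> \<theta>)" for \<rho> \<theta>
  define q' where "q' \<rho> \<theta> = (Re (half_grad h \<rho> \<theta>) + \<rho> * (second_order_term h \<rho> \<theta> + N \<rho> \<theta>)) / (1 + sq_mod h \<rho> \<theta>)
    - 2 * \<rho> * (Re (half_grad h \<rho> \<theta>))\<^sup>2 / (1 + sq_mod h \<rho> \<theta>)\<^sup>2" for \<rho> \<theta>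
  define c where "c \<theta> = Im (half_grad h \<rho> \<theta>) / (1 + sq_mod h \<rho> \<theta>)" for \<theta>
  define c' where "c' \<theta> = (Re (half_grad h \<rho> \<theta>) + \<rho> * second_order_term h \<rho> \<theta> - \<rho> * N \<rho> \<theta>) / (1 + sq_mod h \<rho> \<theta>)
    + 2 * \<rho> * (Im (half_grad h \<rho> \<theta>))\<^sup>2 / (1 + sq_mod h \<rho> \<theta>)\<^sup>2" for \<theta>
  have alg: "((x * B + 1 * A) * s - x * A * (0 + 2 * A)) / (s * s) = (A + x * B) / s - 2 * x * A\<^sup>2 / s\<^sup>2"
    if "s \<noteq> 0" for x A B s :: real
    using that by (simp add: field_simps power2_eq_square)
  have alg': "(B * s - A * (0 + - 2 * x * A)) / (s * s) = B / s + 2 * x * A\<^sup>2 / s\<^sup>2"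
    if "s \<noteq> 0" for x A B s :: real
    using that by (simp add: field_simps power2_eq_square)
  have dq: "((\<lambda>\<rho>. q \<rho> \<theta>) has_real_derivative q' \<rho> \<theta>) (at \<rho>)" if "\<bar>\<rho>\<bar> < 1" for \<rho> \<theta>
    unfolding q_def
    by (rule DERIV_cong[OF DERIV_divide[OF DERIV_mult'[OF DERIV_ident half_grad_radial[OF that]]
          DERIV_add[OF DERIV_const sq_mod_radial[OF that]]]])
      (simp, unfold q'_def N_def, rule alg, simp)
  have dc: "(c has_real_derivative c' \<theta>) (at \<theta>)" for \<theta>
    unfolding c_def[abs_def]
    by (rule DERIV_cong[OF DERIV_divide[OF half_grad_angular[OF \<rho>]
          DERIV_add[OF DERIV_const sq_mod_angular[OF \<rho>]]]])
      (simp, unfold c'_def N_def, rule alg', simp)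
  have q'c': "q' \<rho> \<theta> = 2 * \<rho> * sphere_density h (\<rho> * cis \<theta>) + c' \<theta>" for \<theta>
  proof -
    define s where "s = 1 + sq_mod h \<rho> \<theta>"
    have s: "s \<noteq> 0" by (simp add: s_def)
    have "q' \<rho> \<theta> - c' \<theta> = 2 * \<rho> * N \<rho> \<theta> / s
       - 2 * \<rho> * ((Re (half_grad h \<rho> \<theta>))\<^sup>2 + (Im (half_grad h \<rho> \<theta>))\<^sup>2) / s\<^sup>2"
      unfolding q'_def c'_def s_def[symmetric] using s by (simp add: field_simps power2_eq_square)
    also have "\<dots> = 2 * \<rho> * N \<rho> \<theta> / s - 2 * \<rho> * (N \<rho> \<theta> * (s - 1)) / s\<^sup>2"
      by (subst cmod_half_grad_sq) (simp add: N_def s_def)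
    also have "\<dots> = 2 * \<rho> * (N \<rho> \<theta> / s\<^sup>2)"
      using s by (simp add: field_simps power2_eq_square)
    finally show ?thesis by (simp add: sphere_density_polar N_def s_def)
  qed
  have cq': "continuous_on ({-1<..<1} \<times> cbox 0 (2*pi)) (\<lambda>(\<rho>, \<theta>). q' \<rho> \<theta>)"
    unfolding q'_def N_def split_beta
    by (intro continuous_intros continuous_on_polar_fields) auto
  have iq: "q x integrable_on cbox 0 (2*pi)" if "x \<in> {-1<..<1}" for x
    unfolding q_def[abs_def]
    by (rule integrable_continuous, intro continuous_intros continuous_on_circle_fields) (use that in auto)
  have "((\<lambda>\<rho>. integral (cbox 0 (2*pi)) (q \<rho>)) has_real_derivative integral (cbox 0 (2*pi)) (q' \<rho>)) (at \<rho> within {-1<..<1})"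
    by (rule leibniz_rule_field_derivative[OF _ iq cq']) (use \<rho> in \<open>auto intro!: DERIV_subset[OF dq]\<close>)
  then have Q: "((\<lambda>\<rho>. integral {0..2*pi} (q \<rho>)) has_real_derivative integral {0..2*pi} (q' \<rho>)) (at \<rho>)"
    using at_within_open[of \<rho> "{-1<..<1}"] \<rho> by (simp add: abs_less_iff)
  have "(c' has_integral (c (2*pi) - c 0)) {0..2*pi}"
    by (rule fundamental_theorem_of_calculus)
      (auto simp: has_real_derivative_iff_has_vector_derivative[symmetric] intro: DERIV_subset[OF dc])
  then have c0: "(c' has_integral 0) {0..2*pi}"
    by (simp add: c_def half_grad_def sq_mod_def)
  have d: "(\<lambda>\<theta>. sphere_density h (\<rho> * cis \<theta>)) integrable_on {0..2*pi}"
    unfolding sphere_density_polar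
    by (rule integrable_continuous_interval, intro continuous_intros continuous_on_circle_fields) (use \<rho> in auto)
  have "integral {0..2*pi} (q' \<rho>) = 2 * \<rho> * integral {0..2*pi} (\<lambda>\<theta>. sphere_density h (\<rho> * cis \<theta>)) + 0"
    unfolding q'c' by (intro integral_unique has_integral_add has_integral_mult_right c0 integrable_integral d)
  with DERIV_cdivide[OF Q, of 2] show ?thesis
    unfolding flux_def[abs_def] q_def[symmetric] by simp
qed

lemma height_deriv:
  assumes \<rho>: "\<bar>\<rho>\<bar> < 1"
  shows "(height h has_real_derivative integral {0..2*pi} (\<lambda>\<theta>. Re (half_grad h \<rho> \<theta>) / (1 + sq_mod h \<rho> \<theta>)\<^sup>2)) (at \<rho>)"
proof -
  define m where "m \<rho> \<theta> = sq_mod h \<rho> \<theta> / (1 + sq_mod h \<rho> \<theta>)" for \<rho> \<theta>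
  define m' where "m' \<rho> \<theta> = 2 * (Re (half_grad h \<rho> \<theta>) / (1 + sq_mod h \<rho> \<theta>)\<^sup>2)" for \<rho> \<theta>
  have dm: "((\<lambda>\<rho>. m \<rho> \<theta>) has_real_derivative m' \<rho> \<theta>) (at \<rho>)" if "\<bar>\<rho>\<bar> < 1" for \<rho> \<theta>
    unfolding m_def
    by (rule DERIV_cong[OF DERIV_divide[OF sq_mod_radial[OF that] DERIV_add[OF DERIV_const sq_mod_radial[OF that]]]])
      (simp_all add: m'_def power2_eq_square algebra_simps)
  have cm': "continuous_on ({-1<..<1} \<times> cbox 0 (2*pi)) (\<lambda>(\<rho>, \<theta>). m' \<rho> \<theta>)"
    unfolding m'_def split_beta
    by (intro continuous_intros continuous_on_polar_fields) auto
  have im: "m x integrable_on cbox 0 (2*pi)" if "x \<in> {-1<..<1}" for x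
    unfolding m_def[abs_def]
    by (rule integrable_continuous, intro continuous_intros continuous_on_circle_fields) (use that in auto)
  have "((\<lambda>\<rho>. integral (cbox 0 (2*pi)) (m \<rho>)) has_real_derivative integral (cbox 0 (2*pi)) (m' \<rho>)) (at \<rho> within {-1<..<1})"
    by (rule leibniz_rule_field_derivative[OF _ im cm']) (use \<rho> in \<open>auto intro!: DERIV_subset[OF dm]\<close>)
  then have "((\<lambda>\<rho>. integral {0..2*pi} (m \<rho>)) has_real_derivative integral {0..2*pi} (m' \<rho>)) (at \<rho>)"
    using at_within_open[of \<rho> "{-1<..<1}"] \<rho> by (simp add: abs_less_iff)
  moreover have "integral {0..2*pi} (m' \<rho>) = 2 * integral {0..2*pi} (\<lambda>\<theta>. Re (half_grad h \<rho> \<theta>) / (1 + sq_mod h \<rho> \<theta>)\<^sup>2)"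
    unfolding m'_def by (rule integral_mult_right)
  ultimately show ?thesis
    using DERIV_cdivide[of _ _ \<rho> UNIV 2] unfolding height_def[abs_def] m_def[symmetric] by fastforce
qed

text \<open>Let \<open>Y = h / (1 + |h|\<^sup>2)\<close>, half of the horizontal part of the stereographic image of \<open>h\<close>. Up to
  the factor \<open>\<rho>\<close>, the derivative of the height is the signed area integral \<open>\<integral> Im (cnj Y Y\<^sub>\<theta>)\<close> of
  the horizontally projected circle, while \<open>|Y\<^sub>\<theta>|\<close> is at most the speed \<open>\<rho> |h'| / (1 + |h|\<^sup>2)\<close>
  of the circle on the sphere. Hence the planar inequality for \<open>Y\<close> gives the bound.\<close>

lemma height_deriv_bound:
  assumes \<rho>: "0 \<le> \<rho>" "\<rho> < 1"
  shows "\<rho> * \<bar>integral {0..2*pi} (\<lambda>\<theta>. Re (half_grad h \<rho> \<theta>) / (1 + sq_mod h \<rho> \<theta>)\<^sup>2)\<bar> \<le>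
    \<rho>\<^sup>2 * integral {0..2*pi} (\<lambda>\<theta>. sphere_density h (\<rho> * cis \<theta>))"
proof -
  have \<rho>1: "\<bar>\<rho>\<bar> < 1" using \<rho> by simp
  let ?z = "\<lambda>\<theta>. complex_of_real \<rho> * cis \<theta>"
  let ?s = "\<lambda>\<theta>. 1 + sq_mod h \<rho> \<theta>"
  let ?w = "half_grad h \<rho>"
  define d where "d \<theta> = deriv h (?z \<theta>) * (\<i> * \<rho> * cis \<theta>)" for \<theta>
  define Y where "Y \<theta> = (1 / ?s \<theta>) *\<^sub>R h (?z \<theta>)" for \<theta>
  define Y' where "Y' \<theta> = (1 / ?s \<theta>) *\<^sub>R d \<theta> + (2 * \<rho> * Im (?w \<theta>) / (?s \<theta>)\<^sup>2) *\<^sub>R h (?z \<theta>)" for \<theta>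
  have dh: "((\<lambda>\<theta>. h (?z \<theta>)) has_vector_derivative d \<theta>) (at \<theta>)" for \<theta>
    unfolding d_def by (rule has_vector_derivative_angular[OF holo \<rho>1])
  have ds: "((\<lambda>\<theta>. 1 / ?s \<theta>) has_real_derivative 2 * \<rho> * Im (?w \<theta>) / (?s \<theta>)\<^sup>2) (at \<theta>)" for \<theta>
    by (rule DERIV_cong[OF DERIV_divide[OF DERIV_const DERIV_add[OF DERIV_const sq_mod_angular[OF \<rho>1]]]])
      (simp_all add: power2_eq_square)
  have dY: "(Y has_vector_derivative Y' \<theta>) (at \<theta>)" for \<theta>
    unfolding Y_def[abs_def] Y'_def
    by (rule has_vector_derivative_scaleR[OF ds dh])
  have ccis: "continuous_on UNIV ?z" by (intro continuous_intros)
  have cont: "continuous_on UNIV (\<lambda>\<theta>. h (?z \<theta>))" "continuous_on UNIV (\<lambda>\<theta>. deriv h (?z \<theta>))"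
    using holo deriv_holo \<rho>1
    by (auto intro!: continuous_on_compose2[OF holomorphic_on_imp_continuous_on ccis] simp: norm_mult)
  have cY': "continuous_on UNIV Y'"
    unfolding Y'_def[abs_def] d_def
    by (intro continuous_intros continuous_on_circle_fields cont \<rho>1) auto
  have cis_per: "cis (\<theta> + 2 * pi) = cis \<theta>" for \<theta>
    by (simp add: cis_mult[symmetric])
  have per: "Y (\<theta> + 2 * pi) = Y \<theta>" "Y' (\<theta> + 2 * pi) = Y' \<theta>" for \<theta>
    by (simp_all add: Y_def Y'_def d_def sq_mod_def half_grad_def cis_per)
  have dw: "cnj (h (?z \<theta>)) * d \<theta> = \<i> * \<rho> * ?w \<theta>" for \<theta>
    by (simp add: d_def half_grad_def)
  have ImY: "Im (cnj (Y \<theta>) * Y' \<theta>) = \<rho> * (Re (?w \<theta>) / (?s \<theta>)\<^sup>2)" for \<theta>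
  proof -
    have "cnj (Y \<theta>) * Y' \<theta> = (1 / (?s \<theta>)\<^sup>2) *\<^sub>R (cnj (h (?z \<theta>)) * d \<theta>)
       + (2 * \<rho> * Im (?w \<theta>) / (?s \<theta>)^3) *\<^sub>R (cnj (h (?z \<theta>)) * h (?z \<theta>))"
      by (simp add: Y_def Y'_def algebra_simps power2_eq_square power3_eq_cube)
    then show ?thesis unfolding dw by simp
  qed
  have cY: "(cmod (Y' \<theta>))\<^sup>2 \<le> \<rho>\<^sup>2 * sphere_density h (?z \<theta>)" for \<theta>
  proof -
    define s where "s = ?s \<theta>"
    have s: "s > 0" "s = 1 + (cmod (h (?z \<theta>)))\<^sup>2" using one_plus_sq_mod_pos by (simp_all add: s_def sq_mod_def)
    define b where "b = 2 * \<rho> * Im (?w \<theta>) / s\<^sup>2"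
    have "(cmod (Y' \<theta>))\<^sup>2 = (cmod (d \<theta>))\<^sup>2 / s\<^sup>2 + 2 * b / s * Re (cnj (h (?z \<theta>)) * d \<theta>) + b\<^sup>2 * (cmod (h (?z \<theta>)))\<^sup>2"
      unfolding Y'_def s_def[symmetric] b_def[symmetric] 
      using s(1) unfolding cmod_power2 by (simp add: power2_eq_square field_simps)
    also have "Re (cnj (h (?z \<theta>)) * d \<theta>) = - (b * s\<^sup>2 / 2)"
      unfolding dw using s(1) by (simp add: b_def)
    also have "(cmod (h (?z \<theta>)))\<^sup>2 = s - 1" using s by simp
    also have "(cmod (d \<theta>))\<^sup>2 / s\<^sup>2 + 2 * b / s * - (b * s\<^sup>2 / 2) + b\<^sup>2 * (s - 1) = (cmod (d \<theta>))\<^sup>2 / s\<^sup>2 - b\<^sup>2"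
      using s(1) by (simp add: power2_eq_square field_simps)
    also have "\<dots> \<le> (cmod (d \<theta>))\<^sup>2 / s\<^sup>2" by simp
    also have "\<dots> = \<rho>\<^sup>2 * sphere_density h (?z \<theta>)"
      unfolding sphere_density_polar by (simp add: d_def s_def norm_mult power_mult_distrib)
    finally show ?thesis .
  qed
  have d: "(\<lambda>\<theta>. sphere_density h (?z \<theta>)) integrable_on {0..2*pi}"
    unfolding sphere_density_polar
    by (rule integrable_continuous_interval, intro continuous_intros continuous_on_circle_fields) (use \<rho> in auto)
  have "\<bar>integral {0..2*pi} (\<lambda>\<theta>. \<rho> * (Re (?w \<theta>) / (?s \<theta>)\<^sup>2))\<bar> \<le> integral {0..2*pi} (\<lambda>\<theta>. (cmod (Y' \<theta>))\<^sup>2)"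
    using planar_isoperimetric[OF dY cY' per] unfolding ImY .
  also have "\<dots> \<le> integral {0..2*pi} (\<lambda>\<theta>. \<rho>\<^sup>2 * sphere_density h (?z \<theta>))"
    by (rule integral_le) (auto intro!: cY integrable_continuous_interval continuous_intros continuous_on_subset[OF cY'] integrable_on_mult_right d)
  also have "integral {0..2*pi} (\<lambda>\<theta>. \<rho> * (Re (?w \<theta>) / (?s \<theta>)\<^sup>2)) = \<rho> * integral {0..2*pi} (\<lambda>\<theta>. Re (?w \<theta>) / (?s \<theta>)\<^sup>2)"
    by (rule integral_mult_right)
  finally show ?thesis
    using \<rho> by (simp add: abs_mult)
qed

text \<open>The sum of height and flux increases with the radius: its derivative is nonnegative by the
  bound on the derivative of the height. The lower bound is the value at radius \<open>0\<close>.\<close>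

lemma height_plus_flux_ge:
  assumes r: "0 \<le> r" "r < 1"
  shows "pi * (cmod (h 0))\<^sup>2 / (1 + (cmod (h 0))\<^sup>2) \<le> height h r + flux h r"
proof -
  let ?H = "\<lambda>\<rho>. integral {0..2*pi} (\<lambda>\<theta>. Re (half_grad h \<rho> \<theta>) / (1 + sq_mod h \<rho> \<theta>)\<^sup>2)"
  let ?D = "\<lambda>\<rho>. integral {0..2*pi} (\<lambda>\<theta>. sphere_density h (\<rho> * cis \<theta>))"
  have der: "((\<lambda>\<rho>. height h \<rho> + flux h \<rho>) has_real_derivative ?H \<rho> + \<rho> * ?D \<rho>) (at \<rho>)" if "\<bar>\<rho>\<bar> < 1" for \<rho>
    by (intro DERIV_add height_deriv flux_deriv that)
  have "height h 0 + flux h 0 \<le> height h r + flux h r"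
  proof (rule DERIV_nonneg_imp_increasing_open[OF r(1)])
    fix \<rho> assume \<rho>: "0 < \<rho>" "\<rho> < r"
    have "\<rho> * \<bar>?H \<rho>\<bar> \<le> \<rho> * (\<rho> * ?D \<rho>)"
      using height_deriv_bound[of \<rho>] \<rho> r by (simp add: power2_eq_square mult.assoc)
    then have "\<bar>?H \<rho>\<bar> \<le> \<rho> * ?D \<rho>" using \<rho> by simp
    then show "\<exists>y. ((\<lambda>\<rho>. height h \<rho> + flux h \<rho>) has_real_derivative y) (at \<rho>) \<and> 0 \<le> y"
      using der[of \<rho>] \<rho> r by (intro exI conjI) auto
  next
    show "continuous_on {0..r} (\<lambda>\<rho>. height h \<rho> + flux h \<rho>)"
      using r by (intro continuous_at_imp_continuous_on ballI DERIV_isCont[OF der]) auto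
  qed
  moreover have "flux h 0 = 0" by (simp add: flux_def)
  moreover have "height h 0 = (2 * pi) * ((cmod (h 0))\<^sup>2 / (1 + (cmod (h 0))\<^sup>2)) / 2"
    by (simp add: height_def sq_mod_def)
  ultimately show ?thesis unfolding double_half by simp
qed

lemma area_eq_flux:
  assumes r: "0 < r" "r < 1"
  shows "(LINT z:ball 0 r|lebesgue. sphere_density h z) = flux h r"
proof -
  have "continuous_on (cball 0 r) h" "continuous_on (cball 0 r) (deriv h)"
    using r by (auto intro!: continuous_on_subset[OF holomorphic_on_imp_continuous_on] holo deriv_holo)
  then have "continuous_on (cball 0 r) (sphere_density h)"
    unfolding sphere_density_def[abs_def]
    by (intro continuous_intros) (auto simp: add_nonneg_eq_0_iff)
  then have "(LINT z:ball 0 r|lebesgue. sphere_density h z) = 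
    integral {0..r} (\<lambda>\<rho>. \<rho> * integral {0..2*pi} (\<lambda>\<theta>. sphere_density h (\<rho> * cis \<theta>)))"
    by (rule polar_integral[OF r(1)])
  also have "\<dots> = flux h r - flux h 0"
    using r by (intro integral_unique fundamental_theorem_of_calculus)
      (auto simp: has_real_derivative_iff_has_vector_derivative[symmetric] intro!: DERIV_subset[OF flux_deriv])
  finally show ?thesis by (simp add: flux_def)
qed

end

text \<open>Let \<open>F(z) = r g(z) / z\<close>. On the circle \<open>|z| = r\<close> one has \<open>|F| = |g|\<close> and
  \<open>z g' cnj g = |F|\<^sup>2 + z F' cnj F\<close>. So the area of \<open>g\<close>, which is its flux, equals the height plus
  the flux of \<open>F\<close>, and this is at least the height at the centre, where \<open>|F(0)| = r |g'(0)|\<close>.\<close>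

theorem holomorphic_area_ge:
  assumes g: "g holomorphic_on ball 0 1" and g0: "g 0 = 0" and r: "0 < r" "r < 1"
  shows "pi * (r * cmod (deriv g 0))\<^sup>2 / (1 + (r * cmod (deriv g 0))\<^sup>2)
    \<le> (LINT z:ball 0 r|lebesgue. sphere_density g z)"
proof -
  define G where "G z = (if z = 0 then deriv g 0 else g z / z)" for z
  have G: "G holomorphic_on ball 0 1"
    by (rule pole_theorem_open_0[OF g, of 0]) (auto simp: G_def g0)
  have gG: "g z = z * G z" for z by (simp add: G_def g0)
  define F where "F z = of_real r * G z" for z
  have F: "F holomorphic_on ball 0 1"
    unfolding F_def[abs_def] by (intro holomorphic_intros G)
  have eq: "r * Re (half_grad g r \<theta>) / (1 + sq_mod g r \<theta>) =
    sq_mod F r \<theta> / (1 + sq_mod F r \<theta>) + r * Re (half_grad F r \<theta>) / (1 + sq_mod F r \<theta>)" for \<theta>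
  proof -
    define z where "z = complex_of_real r * cis \<theta>"
    have z: "z \<in> ball 0 1" using r by (simp add: z_def norm_mult)
    have dG: "(G has_field_derivative deriv G z) (at z)"
      by (rule holomorphic_derivI[OF G _ z]) simp
    have "((\<lambda>z. z * G z) has_field_derivative G z + z * deriv G z) (at z)"
      by (auto intro!: derivative_eq_intros dG)
    then have dg: "deriv g z = G z + z * deriv G z"
      unfolding gG[abs_def, symmetric] by (rule DERIV_imp_deriv)
    have "(F has_field_derivative r * deriv G z) (at z)"
      unfolding F_def[abs_def] by (auto intro!: derivative_eq_intros dG)
    then have dF: "deriv F z = r * deriv G z" by (rule DERIV_imp_deriv)
    have s: "sq_mod g r \<theta> = sq_mod F r \<theta>"
      unfolding sq_mod_def z_def[symmetric] using r by (simp add: gG F_def norm_mult) (simp add: z_def norm_mult)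
    have "r * half_grad g r \<theta> = z * deriv g z * cnj (g z)"
      by (simp add: half_grad_def z_def)
    also have "\<dots> = (z * cnj z) * (G z * cnj (G z)) + (z * cnj z) * (z * deriv G z * cnj (G z))"
      by (simp add: dg gG algebra_simps)
    also have "z * cnj z = r\<^sup>2"
      by (subst complex_norm_square[symmetric]) (simp add: z_def norm_mult)
    also have "r\<^sup>2 * (G z * cnj (G z)) = of_real (sq_mod F r \<theta>)"
      unfolding sq_mod_def z_def[symmetric] complex_norm_square by (simp add: F_def power2_eq_square)
    also have "r\<^sup>2 * (z * deriv G z * cnj (G z)) = r * half_grad F r \<theta>"
      unfolding half_grad_def z_def[symmetric] dF by (simp add: F_def z_def power2_eq_square)
    finally have "Re (r * half_grad g r \<theta>) = Re (of_real (sq_mod F r \<theta>) + r * half_grad F r \<theta>)" by simp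
    then show ?thesis by (simp add: s add_divide_distrib)
  qed
  have r': "\<bar>r\<bar> < 1" using r by simp
  have "integral {0..2*pi} (\<lambda>\<theta>. sq_mod F r \<theta> / (1 + sq_mod F r \<theta>) + r * Re (half_grad F r \<theta>) / (1 + sq_mod F r \<theta>))
    = integral {0..2*pi} (\<lambda>\<theta>. sq_mod F r \<theta> / (1 + sq_mod F r \<theta>)) + integral {0..2*pi} (\<lambda>\<theta>. r * Re (half_grad F r \<theta>) / (1 + sq_mod F r \<theta>))"
    by (rule Henstock_Kurzweil_Integration.integral_add; rule integrable_continuous_interval, intro continuous_intros continuous_on_circle_fields[OF F r']) auto
  then have "flux g r = height F r + flux F r"
    unfolding flux_def height_def eq by simp
  moreover have "pi * (cmod (F 0))\<^sup>2 / (1 + (cmod (F 0))\<^sup>2) \<le> height F r + flux F r"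
    using height_plus_flux_ge[OF F] r by simp
  moreover have "cmod (F 0) = r * cmod (deriv g 0)" using r by (simp add: F_def G_def norm_mult)
  ultimately show ?thesis using area_eq_flux[OF g r] by simp
qed

lemma linear_area_eq:
  assumes r: "0 < r" "r < 1"
  shows "(LINT z:ball 0 r|lebesgue. sphere_density (\<lambda>z. \<eta> * z) z) =
    pi * (r * cmod \<eta>)\<^sup>2 / (1 + (r * cmod \<eta>)\<^sup>2)"
proof -
  let ?g = "\<lambda>z. \<eta> * z"
  have holo: "?g holomorphic_on ball 0 1" by (intro holomorphic_intros)
  have "half_grad ?g r \<theta> = of_real (r * (cmod \<eta>)\<^sup>2)" for \<theta>
  proof -
    have "half_grad ?g r \<theta> = r * (\<eta> * cnj \<eta>) * (cis \<theta> * cnj (cis \<theta>))"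
      unfolding half_grad_def by simp
    also have "\<dots> = of_real (r * (cmod \<eta>)\<^sup>2)"
      unfolding complex_norm_square[symmetric] by simp
    finally show ?thesis .
  qed
  moreover have "sq_mod ?g r \<theta> = (r * cmod \<eta>)\<^sup>2" for \<theta>
    using r by (simp add: sq_mod_def norm_mult mult_ac)
  ultimately have "flux ?g r = (2 * pi) * (r * (r * (cmod \<eta>)\<^sup>2) / (1 + (r * cmod \<eta>)\<^sup>2)) / 2"
    by (simp add: flux_def)
  then have "flux ?g r = pi * (r * (r * (cmod \<eta>)\<^sup>2)) / (1 + (r * cmod \<eta>)\<^sup>2)"
    by (rule trans[OF _ double_half])
  also have "r * (r * (cmod \<eta>)\<^sup>2) = (r * cmod \<eta>)\<^sup>2"
    by (simp add: power2_eq_square)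
  finally show ?thesis using area_eq_flux[OF holo r] by simp
qed

section \<open>Spherical isometries and the spherical derivative\<close>

text \<open>The hypothesis \<open>unitary\<close> holds at every \<open>w\<close> if the matrix of the linear fractional map is a
  multiple of a unitary one. The conclusion is then the infinitesimal form of the statement that
  the map is a spherical isometry, applied to the tangent vector \<open>v\<close> at \<open>w\<close>.\<close>

lemma spherical_distortion_linear_fractional:
  fixes a b c d w :: complex
  assumes det: "cmod (a * d - b * c) = k" and k: "k > 0"
    and unitary: "(cmod (a * w + b))\<^sup>2 + (cmod (c * w + d))\<^sup>2 = k * (1 + (cmod w)\<^sup>2)"
    and fin: "c * w + d \<noteq> 0"
  shows "cmod (v * (a * d - b * c) / (c * w + d)\<^sup>2) / (1 + (cmod ((a * w + b) / (c * w + d)))\<^sup>2)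
    = cmod v / (1 + (cmod w)\<^sup>2)"
proof -
  let ?q = "(cmod (c * w + d))\<^sup>2"
  have q: "?q > 0" using fin by simp
  have p: "1 + (cmod w)\<^sup>2 > 0" by (simp add: add_pos_nonneg)
  have "1 + (cmod ((a * w + b) / (c * w + d)))\<^sup>2 = k * (1 + (cmod w)\<^sup>2) / ?q"
    using q unfolding unitary[symmetric] by (simp add: norm_divide power_divide field_simps)
  moreover have "cmod (v * (a * d - b * c) / (c * w + d)\<^sup>2) = cmod v * k / ?q"
    by (simp add: norm_divide norm_mult norm_power det)
  ultimately have "cmod (v * (a * d - b * c) / (c * w + d)\<^sup>2) / (1 + (cmod ((a * w + b) / (c * w + d)))\<^sup>2)
    = (cmod v * k / ?q) / (k * (1 + (cmod w)\<^sup>2) / ?q)" by (simp only:)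
  also have "\<dots> = cmod v / (1 + (cmod w)\<^sup>2)" using q k p by simp
  finally show ?thesis .
qed

lemma Rot_cases:
  assumes "T \<in> Rot"
  obtains a b c d k where "T = linear_fractional a b c d" "cmod (a * d - b * c) = k" "k > 0"
    "\<And>w. (cmod (a * w + b))\<^sup>2 + (cmod (c * w + d))\<^sup>2 = k * (1 + (cmod w)\<^sup>2)"
  using assms unfolding Rot_def
proof (elim UnE CollectE exE conjE)
  fix a \<theta> assume T: "T = linear_fractional (cis \<theta>) (- cis \<theta> * a) (cnj a) 1"
  have 1: "cmod (cis \<theta> * 1 - - cis \<theta> * a * cnj a) = 1 + (cmod a)\<^sup>2"
  proof -
    have "cis \<theta> * 1 - - cis \<theta> * a * cnj a = cis \<theta> * of_real (1 + (cmod a)\<^sup>2)"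
      by (simp add: algebra_simps flip: complex_norm_square)
    then show ?thesis by (simp add: norm_mult del: of_real_add)
  qed
  have 2: "(cmod (cis \<theta> * w + - cis \<theta> * a))\<^sup>2 + (cmod (cnj a * w + 1))\<^sup>2 = (1 + (cmod a)\<^sup>2) * (1 + (cmod w)\<^sup>2)" for w
  proof -
    have "cis \<theta> * w + - cis \<theta> * a = cis \<theta> * (w - a)" by (simp add: algebra_simps)
    then have c: "cmod (cis \<theta> * w + - cis \<theta> * a) = cmod (w - a)" by (simp add: norm_mult)
    show ?thesis unfolding c cmod_power2 by (simp add: cmod_power2 algebra_simps power2_eq_square)
  qed
  show thesis by (rule that[OF T 1 _ 2]) (simp add: add_pos_nonneg)
next
  fix \<theta> assume T: "T = linear_fractional 0 (cis \<theta>) 1 0"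
  show thesis by (rule that[OF T, of 1]) (auto simp: norm_mult)
qed

text \<open>Away from the pole this is the isometry property and the chain rule. Injectivity makes the
  pole of \<open>f\<close> isolated, so that the limit there is determined by the continuity of the right-hand
  side.\<close>

lemma spherical_deriv_Rot:
  assumes T: "T \<in> Rot" and g: "g holomorphic_on ball 0 1" and f: "\<And>z. z \<in> ball 0 1 \<Longrightarrow> f z = T (Some (g z))"
    and inj: "inj_on f (ball 0 1)" and z: "z \<in> ball 0 1"
  shows "spherical_deriv f z = cmod (deriv g z) / (1 + (cmod (g z))\<^sup>2)"
proof -
  obtain a b c d k where Teq: "T = linear_fractional a b c d" and det: "cmod (a * d - b * c) = k" "k > 0"
    and un: "\<And>w. (cmod (a * w + b))\<^sup>2 + (cmod (c * w + d))\<^sup>2 = k * (1 + (cmod w)\<^sup>2)"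
    using Rot_cases[OF T] by blast
  let ?q = "\<lambda>w. cmod (deriv (finite_part f) w) / (1 + (cmod (finite_part f w))\<^sup>2)"
  let ?s = "\<lambda>w. cmod (deriv g w) / (1 + (cmod (g w))\<^sup>2)"
  have f_None: "f w = None \<longleftrightarrow> c * g w + d = 0" if "w \<in> ball 0 1" for w
    by (simp add: f[OF that] Teq linear_fractional_def)
  have fp: "finite_part f w = (a * g w + b) / (c * g w + d)" if "w \<in> ball 0 1" "f w \<noteq> None" for w
    using that by (auto simp: finite_part_def f Teq linear_fractional_def)
  have cont: "continuous_on (ball 0 1) g" using g by (rule holomorphic_on_imp_continuous_on)
  have eq: "?q w = ?s w" if w: "w \<in> ball 0 1" "f w \<noteq> None" for w
  proof -
    have "open (ball 0 1 \<inter> (\<lambda>w. c * g w + d) -` (- {0}))"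
      by (intro continuous_open_preimage continuous_intros cont) auto
    then have "\<forall>\<^sub>F u in nhds w. u \<in> ball 0 1 \<inter> (\<lambda>w. c * g w + d) -` (- {0})"
      by (rule eventually_nhds_in_open) (use w f_None in auto)
    then have ev: "\<forall>\<^sub>F u in nhds w. finite_part f u = (a * g u + b) / (c * g u + d)"
      by eventually_elim (use f_None in \<open>auto intro!: fp\<close>)
    have nz: "c * g w + d \<noteq> 0" using f_None w by auto
    have dg: "(g has_field_derivative deriv g w) (at w)"
      by (rule holomorphic_derivI[OF g _ w(1)]) simp
    have "((\<lambda>u. (a * g u + b) / (c * g u + d)) has_field_derivative
        deriv g w * (a * d - b * c) / (c * g w + d)\<^sup>2) (at w)"
      by (auto intro!: derivative_eq_intros dg simp: nz) (simp add: power2_eq_square algebra_simps)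
    then have "deriv (finite_part f) w = deriv g w * (a * d - b * c) / (c * g w + d)\<^sup>2"
      using deriv_cong_ev[OF ev refl] DERIV_imp_deriv by metis
    then show ?thesis
      using spherical_distortion_linear_fractional[OF det un nz] fp[OF w] by simp
  qed
  show ?thesis
  proof (cases "f z = None")
    case False
    then show ?thesis using eq[OF z] by (simp add: spherical_deriv_def)
  next
    case True
    have cont': "continuous_on (ball 0 1) ?s"
      by (intro continuous_intros cont holomorphic_on_imp_continuous_on[OF holomorphic_deriv[OF g]])
        (auto simp: add_nonneg_eq_0_iff)
    then have "(?s \<longlongrightarrow> ?s z) (at z)"
      using z by (simp add: continuous_on_eq_continuous_at isCont_def)
    moreover have "\<forall>\<^sub>F w in at z. ?s w = ?q w"
    proof -
      have "\<forall>\<^sub>F w in at z. w \<in> ball 0 1 - {z}"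
        using z by (intro eventually_at_in_open) auto
      then show ?thesis
      proof eventually_elim
        case (elim w)
        then have "f w \<noteq> None" using inj True z by (metis Diff_iff inj_onD singletonI)
        then show ?case using eq[of w] elim by simp
      qed
    qed
    ultimately have "(?q \<longlongrightarrow> ?s z) (at z)"
      by (rule Lim_transform_eventually)
    then show ?thesis
      using True by (simp add: spherical_deriv_def tendsto_Lim)
  qed
qed

lemma spherical_area_Rot:
  assumes T: "T \<in> Rot" and g: "g holomorphic_on ball 0 1" and f: "\<And>z. z \<in> ball 0 1 \<Longrightarrow> f z = T (Some (g z))"
    and inj: "inj_on f (ball 0 1)" and r: "r < 1"
  shows "spherical_area f r = (LINT z:ball 0 r|lebesgue. sphere_density g z)"
  unfolding spherical_area_def
proof (rule set_lebesgue_integral_cong)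
  show "\<forall>z. z \<in> ball 0 r \<longrightarrow> (spherical_deriv f z)\<^sup>2 = sphere_density g z"
  proof (intro allI impI)
    fix z :: complex assume "z \<in> ball 0 r"
    then have "z \<in> ball 0 1" using r by simp
    then show "(spherical_deriv f z)\<^sup>2 = sphere_density g z"
      unfolding sphere_density_def by (subst spherical_deriv_Rot[OF T g f inj]) auto
  qed
qed simp

section \<open>Images of spherically convex functions\<close>

lemma norm_stereo: "norm (stereo x) = 1"
proof (cases x)
  case (Some z)
  define s where "s = 1 + (cmod z)\<^sup>2"
  have s: "s > 0" by (simp add: s_def add_pos_nonneg)
  have "(norm (stereo x))\<^sup>2 = (2 / s * cmod z)\<^sup>2 + ((s - 2) / s)\<^sup>2"
    using s by (simp add: Some norm_Pair s_def power_divide power_mult_distrib)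
  also have "\<dots> = (4 * (s - 1) + (s - 2)\<^sup>2) / s\<^sup>2"
    by (simp add: s_def power_divide power_mult_distrib add_divide_distrib)
  also have "\<dots> = 1" using s by (simp add: field_simps power2_eq_square)
  finally show ?thesis by (simp add: abs_square_eq_1)
qed (simp add: norm_Pair)

lemma stereo_inverse:
  assumes "norm (Z, t) = (1 :: real)" "t \<noteq> 1"
  shows "stereo (Some (Z /\<^sub>R (1 - t))) = (Z, t)"
proof -
  have n: "(cmod Z)\<^sup>2 + t\<^sup>2 = 1" using assms(1) by (simp add: norm_Pair)
  have "t\<^sup>2 \<le> 1" using n zero_le_power2[of "cmod Z"] by linarith
  then have t: "1 - t > 0" using assms(2) by (simp add: abs_square_le_1)
  have "1 + (cmod (Z /\<^sub>R (1 - t)))\<^sup>2 = 2 / (1 - t)"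
  proof -
    have "(cmod (Z /\<^sub>R (1 - t)))\<^sup>2 = (1 - t\<^sup>2) / (1 - t)\<^sup>2"
    proof -
      have c: "(cmod Z)\<^sup>2 = 1 - t\<^sup>2" using n by simp
      show ?thesis using t by (simp add: power_mult_distrib c divide_inverse power_inverse mult.commute)
    qed
    also have "1 - t\<^sup>2 = (1 + t) * (1 - t)"
      by (simp add: power2_eq_square algebra_simps)
    also have "\<dots> / (1 - t)\<^sup>2 = (1 + t) / (1 - t)"
      using t by (simp add: power2_eq_square)
    finally show ?thesis using t by (simp add: field_simps)
  qed
  moreover from this have "(cmod (Z /\<^sub>R (1 - t)))\<^sup>2 - 1 = 2 * t / (1 - t)"
    using t by (simp add: field_simps)
  moreover have "(2 - 2 * t) * inverse (1 - t) / 2 = 1" using t by (simp add: field_simps)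
  ultimately show ?thesis
    using t by (simp del: norm_scaleR)
qed

lemma stereo_inj: "stereo x = stereo y \<Longrightarrow> x = y"
proof -
  have 1: "stereo (Some z) \<noteq> (0, 1)" for z
    using add_nonneg_eq_0_iff[of 1 "(cmod z)\<^sup>2"] by (auto simp: field_simps)
  have 2: "z = fst (stereo (Some z)) /\<^sub>R (1 - snd (stereo (Some z)))" for z
  proof -
    define s where "s = 1 + (cmod z)\<^sup>2"
    have s: "s > 0" by (simp add: s_def add_pos_nonneg)
    have "1 - ((cmod z)\<^sup>2 - 1) / s = 2 / s" using s by (simp add: s_def field_simps)
    then show ?thesis using s by (simp flip: s_def)
  qed
  assume "stereo x = stereo y"
  then show ?thesis
    using 1 2 by (cases x; cases y) (metis stereo.simps(1))+
qed

lemma antipodal_sym: "antipodal x y \<Longrightarrow> antipodal y x"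
  by (simp add: antipodal_def)

lemma antipodal_None_iff: "antipodal x None \<longleftrightarrow> x = Some 0"
proof -
  have "stereo (Some 0) = (0, -1)" by simp
  moreover have "(0, 1) = - stereo x \<longleftrightarrow> stereo x = (0, -1)"
  proof -
    have "(0, 1) = - stereo x \<longleftrightarrow> stereo x = - (0, 1)" by (metis minus_minus)
    then show ?thesis by simp
  qed
  ultimately show ?thesis
    using stereo_inj[of x "Some 0"] by (auto simp: antipodal_def)
qed

lemma antipodal_Some: "antipodal (Some b) (Some (- 1 / cnj b))" if "b \<noteq> 0"
proof -
  define s where "s = (cmod b)\<^sup>2"
  have s: "s > 0" using that by (simp add: s_def)
  have c: "(cmod (- 1 / cnj b))\<^sup>2 = 1 / s" by (simp add: norm_divide power_divide s_def)
  have b: "- 1 / cnj b = - (1 / s) *\<^sub>R b"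
    using that by (simp add: s_def scaleR_conv_of_real complex_norm_square field_simps del: of_real_power)
  have e: "1 + 1 / s = (1 + s) / s" "1 / s - 1 = (1 - s) / s" using s by (simp_all add: field_simps)
  have "2 / (1 + 1 / s) * - (1 / s) = - (2 / (1 + s))" using s unfolding e by simp
  moreover have "(1 / s - 1) / (1 + 1 / s) = - ((s - 1) / (1 + s))"
    using s unfolding e by (simp add: minus_divide_left)
  ultimately show ?thesis
    unfolding antipodal_def stereo.simps c s_def[symmetric] by (subst b) simp
qed

text \<open>Any point \<open>x\<close> lies on a half great circle from \<open>p\<close> to its antipode \<open>q\<close>. A point \<open>a\<close> of this
  half circle slightly after \<open>p\<close> is still in the open set \<open>\<Omega>\<close>, and the remaining arc from \<open>a\<close> to
  \<open>q\<close> is shorter than \<open>\<pi>\<close> and contains \<open>x\<close>. It suffices to treat finite \<open>p\<close>, as one point of an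
  antipodal pair is always finite.\<close>

lemma convex_domain_antipodal_UNIV:
  assumes conv: "spherically_convex_domain \<Omega>" and p: "Some p \<in> \<Omega>" and q: "q \<in> \<Omega>" and anti: "antipodal (Some p) q"
  shows "\<Omega> = UNIV"
proof (rule UNIV_eq_I[symmetric])
  fix x
  show "x \<in> \<Omega>"
  proof (cases "x = Some p \<or> x = q")
    case True then show ?thesis using p q by auto
  next
    case False
    define P where "P = stereo (Some p)"
    define X where "X = stereo x"
    have nP: "norm P = 1" and nX: "norm X = 1" unfolding P_def X_def by (rule norm_stereo)+
    have Q: "stereo q = - P" using anti by (simp add: antipodal_def P_def)
    have XP: "X \<noteq> P" "X \<noteq> - P" using False stereo_inj Q by (auto simp: X_def P_def)
    define m where "m = X \<bullet> P"
    define V where "V = X - m *\<^sub>R P"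
    have VP: "V \<bullet> P = 0" using nP by (simp add: V_def m_def inner_diff_left power2_norm_eq_inner[symmetric] dot_square_norm)
    have VV: "V \<bullet> V = 1 - m\<^sup>2"
    proof -
      have "P \<bullet> P = 1" "X \<bullet> X = 1" using nP nX by (simp_all add: norm_eq_1)
      then show ?thesis
        by (simp add: V_def m_def inner_diff_left inner_diff_right inner_commute power2_eq_square)
    qed
    have V0: "V \<noteq> 0"
    proof
      assume "V = 0"
      then have "X = m *\<^sub>R P" by (simp add: V_def)
      moreover then have "\<bar>m\<bar> = 1" using nX nP by simp
      ultimately show False using XP by (auto simp: abs_if split: if_splits)
    qed
    \<comment> \<open>The point \<open>X\<close> is \<open>cos t P + sin t u\<close> with \<open>u\<close> a unit vector orthogonal to \<open>P\<close>.\<close>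
    define u where "u = V /\<^sub>R norm V"
    have u: "norm u = 1" "u \<bullet> P = 0" using V0 VP by (simp_all add: u_def)
    have m: "m\<^sup>2 + (norm V)\<^sup>2 = 1" unfolding power2_norm_eq_inner VV by simp
    define t where "t = arccos m"
    have m1: "\<bar>m\<bar> \<le> 1" using m zero_le_power2[of "norm V"] abs_square_le_1[of m] by linarith
    then have cost: "cos t = m" by (simp add: t_def cos_arccos_abs)
    have sint: "sin t = norm V"
    proof -
      have "sin t = sqrt (1 - m\<^sup>2)" using m1 by (simp add: t_def sin_arccos_abs)
      also have "1 - m\<^sup>2 = (norm V)\<^sup>2" using m by simp
      finally show ?thesis by simp
    qed
    have t: "0 < t" "t < pi"
    proof -
      have "0 \<le> t" "t \<le> pi" using m1 by (auto simp: t_def abs_le_iff intro!: arccos_lbound arccos_ubound)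
      moreover have "sin t \<noteq> 0" using sint V0 by simp
      ultimately show "0 < t" "t < pi" by (auto simp: order.strict_iff_order)
    qed
    have Xeq: "X = cos t *\<^sub>R P + sin t *\<^sub>R u"
      using V0 by (simp add: cost sint u_def V_def)
    define A where "A e = cos e *\<^sub>R P + sin e *\<^sub>R u" for e
    have PP: "P \<bullet> P = 1" and uu: "u \<bullet> u = 1" and Pu: "P \<bullet> u = 0"
      using nP u by (simp_all add: norm_eq_1 inner_commute)
    have nA: "norm (A e) = 1" for e
      using sin_cos_squared_add2[of e]
      by (simp add: norm_eq_1 A_def inner_add_left inner_add_right PP uu Pu u(2) power2_eq_square)
    have P1: "snd P \<noteq> 1"
      unfolding P_def using add_nonneg_eq_0_iff[of 1 "(cmod p)\<^sup>2"] by (auto simp: field_simps)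
    \<comment> \<open>The stereographic preimage of the point \<open>A e\<close> at arc length \<open>e\<close> from \<open>P\<close>.\<close>
    define B where "B e = fst (A e) /\<^sub>R (1 - snd (A e))" for e
    have A0: "A 0 = P" by (simp add: A_def)
    have B0: "B 0 = p"
    proof -
      have "stereo (Some (B 0)) = P"
        using stereo_inverse[of "fst P" "snd P"] nP P1 by (simp add: B_def A0)
      then show ?thesis using stereo_inj[of "Some (B 0)" "Some p"] by (simp add: P_def)
    qed
    have tA: "(A \<longlongrightarrow> A 0) (at 0)"
      unfolding A_def by (intro tendsto_intros)
    have tB: "(B \<longlongrightarrow> B 0) (at 0)"
      unfolding B_def using P1 by (intro tendsto_intros tA) (simp add: A0)
    have op: "open {w. Some w \<in> \<Omega>}"
      using conv continuous_map_Some[of euclidean] unfolding spherically_convex_domain_def continuous_map_def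
      by auto
    have e1: "\<forall>\<^sub>F e in at 0. B e \<in> {w. Some w \<in> \<Omega>}"
      by (rule topological_tendstoD[OF tB op]) (simp add: B0 p)
    have e2: "\<forall>\<^sub>F e in at 0. snd (A e) \<in> - {1}"
      by (rule topological_tendstoD[OF tendsto_snd[OF tA]]) (use P1 A0 in auto)
    have "\<forall>\<^sub>F e in at_right 0. 0 < e \<and> e < t"
      using t eventually_at_right_real[of 0 t] by (auto elim: eventually_mono)
    moreover have "\<forall>\<^sub>F e in at_right 0. B e \<in> {w. Some w \<in> \<Omega>} \<and> snd (A e) \<in> - {1}"
      using e1 e2 by (auto simp: eventually_at_split intro: eventually_conj)
    ultimately have "\<forall>\<^sub>F e in at_right 0. (0 < e \<and> e < t) \<and> B e \<in> {w. Some w \<in> \<Omega>} \<and> snd (A e) \<in> - {1}"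
      by (rule eventually_conj)
    then obtain e where e: "0 < e" "e < t" "Some (B e) \<in> \<Omega>" "snd (A e) \<noteq> 1"
      by (metis (mono_tags, lifting) ComplD eventually_happens' insertI1 mem_Collect_eq trivial_limit_at_right_real)
    define a where "a = Some (B e)"
    have sa: "stereo a = A e"
      using stereo_inverse[of "fst (A e)" "snd (A e)"] nA[of e] e by (simp add: a_def B_def)
    \<comment> \<open>The velocity at \<open>a\<close> of the great circle \<open>A\<close>.\<close>
    define u' where "u' = cos e *\<^sub>R u - sin e *\<^sub>R P"
    have rot: "cos s *\<^sub>R A e + sin s *\<^sub>R u' = A (e + s)" for s
      by (simp add: A_def u'_def cos_add sin_add algebra_simps)
    have nu': "norm u' = 1"
      using sin_cos_squared_add2[of e]
      by (simp add: norm_eq_1 u'_def inner_diff_left inner_diff_right PP uu Pu u(2) power2_eq_square)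
    have u'A: "u' \<bullet> A e = 0"
      by (simp add: u'_def A_def inner_diff_left inner_add_right PP uu Pu u(2))
    have "x \<in> spherical_geodesic a q"
      unfolding spherical_geodesic_def
    proof (intro CollectI exI conjI)
      show "stereo q = cos (pi - e) *\<^sub>R stereo a + sin (pi - e) *\<^sub>R u'"
        unfolding sa rot by (simp add: A_def Q)
      show "stereo x = cos (t - e) *\<^sub>R stereo a + sin (t - e) *\<^sub>R u'"
        unfolding sa rot by (simp add: A_def Xeq[unfolded X_def])
    qed (use e t nu' u'A sa in auto)
    moreover have "\<not> antipodal a q"
    proof
      assume "antipodal a q"
      then have "A e = A 0" using Q sa by (simp add: antipodal_def A0)
      then have "A e \<bullet> u = A 0 \<bullet> u" by simp
      then have "sin e = 0" using u by (simp add: A_def inner_add_left uu Pu)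
      moreover have "sin e > 0" using e t by (intro sin_gt_zero) auto
      ultimately show False by simp
    qed
    ultimately show ?thesis
      using conv e q unfolding spherically_convex_domain_def a_def by blast
  qed
qed

text \<open>Otherwise removing the only pole leaves an injective holomorphic map onto the whole plane,
  and its inverse would be a bounded entire function.\<close>

lemma sphere_meromorphic_not_surj:
  assumes mero: "sphere_meromorphic_on f (ball 0 1)" and inj: "inj_on f (ball 0 1)"
  shows "f ` ball 0 1 \<noteq> UNIV"
proof
  assume surj: "f ` ball 0 1 = UNIV"
  obtain F where F: "F nicely_meromorphic_on ball 0 1"
    and f: "\<And>z. z \<in> ball 0 1 \<Longrightarrow> f z = (if is_pole F z then None else Some (F z))"
    using mero unfolding sphere_meromorphic_on_def by blast
  obtain z0 where z0: "z0 \<in> ball 0 1" "f z0 = None" using surj by (metis UNIV_I imageE)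
  define D where "D = ball 0 1 - {z0}"
  have np: "\<not> is_pole F z" if "z \<in> D" for z
    using that z0 inj f[of z] unfolding D_def by (metis Diff_iff inj_onD singletonI)
  have FD: "f z = Some (F z)" if "z \<in> D" for z
    using np[OF that] f that by (simp add: D_def)
  have "F analytic_on {z}" if "z \<in> D" for z
    using nicely_meromorphic_on_imp_analytic_at[OF F _ np[OF that]] that by (simp add: D_def)
  then have "F analytic_on D" using analytic_on_analytic_at by blast
  then have holo: "F holomorphic_on D" by (rule analytic_imp_holomorphic)
  have injF: "inj_on F D"
  proof (rule inj_onI)
    fix x y assume "x \<in> D" "y \<in> D" "F x = F y"
    then show "x = y" using FD inj unfolding D_def by (metis Diff_iff inj_onD)
  qed
  have img: "F ` D = UNIV"
  proof -
    have "w \<in> F ` D" for w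
    proof -
      obtain z where z: "z \<in> ball 0 1" "f z = Some w" using surj by (metis UNIV_I imageE)
      then have "z \<in> D" using z0 by (auto simp: D_def)
      then show ?thesis using FD z by force
    qed
    then show ?thesis by blast
  qed
  have "open D" by (simp add: D_def open_delete)
  obtain G where G: "G holomorphic_on (F ` D)" "\<And>z. z \<in> D \<Longrightarrow> G (F z) = z"
    by (rule holomorphic_has_inverse[OF holo \<open>open D\<close> injF]) blast
  have "range G \<subseteq> ball 0 1"
    using G(2) img by (metis Diff_iff D_def UNIV_I imageE image_subsetI)
  then have "bounded (range G)" using bounded_ball bounded_subset by blast
  then have "G constant_on UNIV" using Liouville_theorem G(1) img by simp
  then obtain v where v: "\<And>w. G w = v" by (auto simp: constant_on_def)
  have "D \<subseteq> {v}" using G(2) v by force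
  then have "finite D" using finite_subset by blast
  then have "countable (ball (0::complex) 1)" by (simp add: D_def countable_finite)
  then show False using uncountable_ball[of 1 "0::complex"] by simp
qed

lemma convex_function_no_antipodal_values:
  assumes f: "spherically_convex_function f" and x: "x \<in> f ` ball 0 1" and y: "y \<in> f ` ball 0 1"
  shows "\<not> antipodal x y"
proof
  assume a: "antipodal x y"
  have conv: "spherically_convex_domain (f ` ball 0 1)" and nUNIV: "f ` ball 0 1 \<noteq> UNIV"
    using f sphere_meromorphic_not_surj by (auto simp: spherically_convex_function_def)
  show False
  proof (cases x)
    case (Some p)
    then show False using convex_domain_antipodal_UNIV[OF conv _ y] x a nUNIV by blast
  next
    case None
    then have "y = Some 0" using a antipodal_sym antipodal_None_iff by blast
    then show False using convex_domain_antipodal_UNIV[OF conv _ x] y a nUNIV antipodal_sym by blast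
  qed
qed

text \<open>Take for \<open>T\<close> a rotation with \<open>T(0) = f(0)\<close> and let \<open>g = T\<^sup>-\<^sup>1 \<circ> f\<close>. Since \<open>\<infinity>\<close> is the antipode of
  \<open>0\<close>, a pole of \<open>g\<close> would be a point where \<open>f\<close> takes the antipodal value of \<open>f(0)\<close>, which does
  not exist. At the pole of \<open>f\<close> the function \<open>g\<close> has a removable singularity.\<close>

lemma spherically_convex_normalization:
  assumes sc: "spherically_convex_function f"
  obtains T g where "T \<in> Rot" "g holomorphic_on ball 0 1" "g 0 = 0" "\<And>z. z \<in> ball 0 1 \<Longrightarrow> f z = T (Some (g z))"
proof -
  have mero: "sphere_meromorphic_on f (ball 0 1)" and inj: "inj_on f (ball 0 1)"
    using sc by (auto simp: spherically_convex_function_def)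
  obtain F where F: "F nicely_meromorphic_on ball 0 1"
    and f: "\<And>z. z \<in> ball 0 1 \<Longrightarrow> f z = (if is_pole F z then None else Some (F z))"
    using mero unfolding sphere_meromorphic_on_def by blast
  define K where "K = {z \<in> ball 0 1. is_pole F z}"
  have K: "finite K"
  proof (cases "K = {}")
    case False
    then obtain z0 where z0: "z0 \<in> K" by blast
    have "z = z0" if "z \<in> K" for z
      by (rule inj_onD[OF inj]) (use that z0 f in \<open>auto simp: K_def\<close>)
    then have "K \<subseteq> {z0}" by blast
    then show ?thesis using finite_subset by blast
  qed simp
  have holoF: "F holomorphic_on (ball 0 1 - K)"
  proof -
    have "F analytic_on {z}" if "z \<in> ball 0 1 - K" for z
      by (rule nicely_meromorphic_on_imp_analytic_at[OF F]) (use that in \<open>auto simp: K_def\<close>)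
    then show ?thesis using analytic_on_analytic_at analytic_imp_holomorphic by blast
  qed
  have extend: "g holomorphic_on ball 0 1"
    if hol: "G holomorphic_on (ball 0 1 - K)" and g: "\<And>z. z \<in> ball 0 1 - K \<Longrightarrow> g z = G z" 
      and lim: "\<And>z. z \<in> K \<Longrightarrow> (G \<longlongrightarrow> g z) (at z)" for g G
  proof (rule no_isolated_singularity'[OF _ _ open_ball K])
    have h: "g holomorphic_on (ball 0 1 - K)" 
      by (rule holomorphic_transform[OF hol]) (simp add: g)
    then show "g holomorphic_on (ball 0 1 - K)" .
    fix z assume z: "z \<in> K"
    have "open (ball 0 1 - (K - {z}))" using K by (intro open_Diff finite_imp_closed) auto
    then have "\<forall>\<^sub>F w in at z. w \<in> ball 0 1 - (K - {z}) - {z}"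
      by (rule eventually_at_in_open) (use z in \<open>auto simp: K_def\<close>)
    then have "\<forall>\<^sub>F w in at z. G w = g w" by eventually_elim (auto simp: g)
    then have "(g \<longlongrightarrow> g z) (at z)" using lim[OF z] by (rule Lim_transform_eventually[rotated])
    then show "(g \<longlongrightarrow> g z) (at z within ball 0 1)" using tendsto_within_subset by blast
  qed
  have poleF: "filterlim F at_infinity (at z)" if "z \<in> K" for z
    using that by (simp add: K_def is_pole_def)
  have val0: "f 0 \<in> f ` ball 0 1" by simp
  note anti = convex_function_no_antipodal_values[OF sc]
  show thesis
  proof (cases "f 0")
    case None
    define g where "g z = (if is_pole F z then 0 else inverse (F z))" for z
    have one_div_inverse: "1 / inverse w = w" for w :: complex
      by (simp only: divide_inverse inverse_inverse_eq mult_1_left)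
    have nz: "F z \<noteq> 0" if "z \<in> ball 0 1" "\<not> is_pole F z" for z
    proof
      assume "F z = 0"
      then have "f z = Some 0" using f that by simp
      then have "antipodal (f z) (f 0)" using None antipodal_None_iff by simp
      then show False using anti[of "f z" "f 0"] that(1) by simp
    qed
    show thesis
    proof (rule that)
      \<comment> \<open>The rotation \<open>1 / z\<close>, which is its own inverse.\<close>
      show "linear_fractional 0 (cis 0) 1 0 \<in> Rot" unfolding Rot_def by blast
      show "g holomorphic_on ball 0 1"
      proof (rule extend)
        show "(\<lambda>z. inverse (F z)) holomorphic_on ball 0 1 - K"
          by (intro holomorphic_intros holoF) (use nz in \<open>auto simp: K_def\<close>)
        show "((\<lambda>z. inverse (F z)) \<longlongrightarrow> g z) (at z)" if "z \<in> K" for z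
          using filterlim_compose[OF tendsto_inverse_0 poleF[OF that]] that by (simp add: g_def K_def)
      qed (auto simp: g_def K_def)
      show "g 0 = 0" using None f[of 0] by (auto simp: g_def split: if_splits)
      show "f z = linear_fractional 0 (cis 0) 1 0 (Some (g z))" if "z \<in> ball 0 1" for z
        using f[OF that] nz[OF that] by (auto simp: linear_fractional_def g_def one_div_inverse)
    qed
  next
    case (Some b)
    define g where "g z = (if is_pole F z then 1 / cnj b else (F z - b) / (1 + cnj b * F z))" for z
    have nz: "1 + cnj b * F z \<noteq> 0" if "z \<in> ball 0 1" "\<not> is_pole F z" for z
    proof
      assume e: "1 + cnj b * F z = 0"
      then have b: "b \<noteq> 0" by auto
      then have "F z = - 1 / cnj b" using e by (simp add: field_simps eq_neg_iff_add_eq_0)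
      then have "f z = Some (- 1 / cnj b)" using f that by simp
      then have "antipodal (f 0) (f z)" using antipodal_Some[OF b] Some by (simp only:)
      then show False using anti[OF val0 imageI[OF that(1)]] by contradiction
    qed
    have b0: "b \<noteq> 0" if "z \<in> ball 0 1" "is_pole F z" for z
    proof
      assume "b = 0"
      moreover have "f z = None" using f that by simp
      ultimately have "antipodal (f 0) (f z)" using Some antipodal_None_iff by (simp only:)
      then show False using anti[OF val0 imageI[OF that(1)]] by contradiction
    qed
    show thesis
    proof (rule that)
      \<comment> \<open>The rotation \<open>(z + b) / (1 - z cnj b)\<close>, written in the form in which \<open>Rot\<close> lists it.\<close>
      show "linear_fractional (cis 0) (- cis 0 * (- b)) (cnj (- b)) 1 \<in> Rot" unfolding Rot_def by blast
      show "g holomorphic_on ball 0 1"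
      proof (rule extend)
        show "(\<lambda>z. (F z - b) / (1 + cnj b * F z)) holomorphic_on ball 0 1 - K"
          by (intro holomorphic_intros holoF) (use nz in \<open>auto simp: K_def\<close>)
        show "((\<lambda>z. (F z - b) / (1 + cnj b * F z)) \<longlongrightarrow> g z) (at z)" if z: "z \<in> K" for z
        proof -
          have "b \<noteq> 0" using b0 z by (auto simp: K_def)
          have inv: "((\<lambda>z. inverse (F z)) \<longlongrightarrow> 0) (at z)"
            using filterlim_compose[OF tendsto_inverse_0 poleF[OF z]] .
          have "((\<lambda>z. (1 - b * inverse (F z)) / (inverse (F z) + cnj b)) \<longlongrightarrow> (1 - b * 0) / (0 + cnj b)) (at z)"
            by (intro tendsto_intros inv) (use \<open>b \<noteq> 0\<close> in auto)
          moreover have "\<forall>\<^sub>F w in at z. (1 - b * inverse (F w)) / (inverse (F w) + cnj b) = (F w - b) / (1 + cnj b * F w)"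
          proof -
            have "\<forall>\<^sub>F w in at z. F w \<noteq> 0"
              using poleF[OF z] by (rule filterlim_at_infinity_imp_eventually_ne)
            then show ?thesis
            proof eventually_elim
              case (elim w)
              have "(1 - b * inverse (F w)) / (inverse (F w) + cnj b) 
                = (F w * (1 - b * inverse (F w))) / (F w * (inverse (F w) + cnj b))" using elim by simp
              also have "\<dots> = (F w - b) / (1 + cnj b * F w)" using elim by (simp add: algebra_simps)
              finally show ?case .
            qed
          qed
          ultimately have "((\<lambda>z. (F z - b) / (1 + cnj b * F z)) \<longlongrightarrow> (1 - b * 0) / (0 + cnj b)) (at z)"
            by (rule Lim_transform_eventually)
          then show ?thesis using z by (simp add: g_def K_def)
        qed
      qed (auto simp: g_def K_def)
      show "g 0 = 0" using Some f[of 0] by (auto simp: g_def split: if_splits)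
      show "f z = linear_fractional (cis 0) (- cis 0 * (- b)) (cnj (- b)) 1 (Some (g z))" if z: "z \<in> ball 0 1" for z
      proof (cases "is_pole F z")
        case True
        then show ?thesis using f[OF z] b0[OF z] by (simp add: linear_fractional_def g_def)
      next
        case False
        define s where "s = 1 + cnj b * F z"
        have s: "s \<noteq> 0" using nz[OF z False] by (simp add: s_def)
        have n: "1 + cnj b * b \<noteq> 0"
        proof -
          have "1 + cnj b * b = of_real (1 + (cmod b)\<^sup>2)" by (simp add: complex_norm_square mult.commute del: of_real_power)
          moreover have "1 + (cmod b)\<^sup>2 \<noteq> 0" using add_nonneg_eq_0_iff[of 1 "(cmod b)\<^sup>2"] by auto
          ultimately show ?thesis by (metis of_real_eq_0_iff)
        qed
        have gz: "g z = (F z - b) / s" using False by (simp add: g_def s_def)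
        have 1: "1 - cnj b * g z = (1 + cnj b * b) / s"
          using s by (simp add: gz field_simps) (simp add: s_def algebra_simps)
        have 2: "g z + b = F z * (1 + cnj b * b) / s"
          using s by (simp add: gz field_simps) (simp add: s_def algebra_simps)
        have "(g z + b) / (1 - cnj b * g z) = F z" unfolding 1 2 using s n by simp
        moreover have "1 - cnj b * g z \<noteq> 0" unfolding 1 using s n by simp
        ultimately show ?thesis using f[OF z] False by (simp add: linear_fractional_def)
      qed
    qed
  qed
qed

section \<open>The area bound\<close>

theorem corollary1p2:
  fixes f :: "complex \<Rightarrow> riemann_sphere"
  assumes "spherically_convex_function f"
  shows "(\<forall>r. 0 < r \<and> r < 1 \<longrightarrow>
            spherical_area f r \<ge>
              pi * r\<^sup>2 / (1 + r\<^sup>2 * (spherical_deriv f 0)\<^sup>2) * (spherical_deriv f 0)\<^sup>2) \<and>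
         ((\<exists>T\<in>Rot. \<exists>\<eta>::complex. 0 < cmod \<eta> \<and> cmod \<eta> \<le> 1 \<and>
              (\<forall>z\<in>ball 0 1. f z = T (Some (\<eta> * z)))) \<longrightarrow>
          (\<forall>r. 0 < r \<and> r < 1 \<longrightarrow>
            spherical_area f r =
              pi * r\<^sup>2 / (1 + r\<^sup>2 * (spherical_deriv f 0)\<^sup>2) * (spherical_deriv f 0)\<^sup>2))"
proof -
  have inj: "inj_on f (ball 0 1)"
    using assms by (simp add: spherically_convex_function_def)
  have bound: "pi * r\<^sup>2 / (1 + r\<^sup>2 * (spherical_deriv f 0)\<^sup>2) * (spherical_deriv f 0)\<^sup>2
      = pi * (r * cmod (deriv g 0))\<^sup>2 / (1 + (r * cmod (deriv g 0))\<^sup>2)"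
    if "T \<in> Rot" "g holomorphic_on ball 0 1" "g 0 = 0" "\<And>z. z \<in> ball 0 1 \<Longrightarrow> f z = T (Some (g z))" for T g r
    using spherical_deriv_Rot[OF that(1,2,4) inj, of 0] that(3)
    by (simp add: power_mult_distrib)
  show ?thesis
  proof (intro conjI impI allI)
    fix r :: real assume r: "0 < r \<and> r < 1"
    obtain T g where Tg: "T \<in> Rot" "g holomorphic_on ball 0 1" "g 0 = 0"
      "\<And>z. z \<in> ball 0 1 \<Longrightarrow> f z = T (Some (g z))"
      using spherically_convex_normalization[OF assms] by blast
    show "pi * r\<^sup>2 / (1 + r\<^sup>2 * (spherical_deriv f 0)\<^sup>2) * (spherical_deriv f 0)\<^sup>2 \<le> spherical_area f r"
      using holomorphic_area_ge[OF Tg(2,3)] r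
      by (simp only: bound[OF Tg] spherical_area_Rot[OF Tg(1,2,4) inj])
  next
    fix r :: real assume r: "0 < r \<and> r < 1"
    assume "\<exists>T\<in>Rot. \<exists>\<eta>::complex. 0 < cmod \<eta> \<and> cmod \<eta> \<le> 1 \<and> (\<forall>z\<in>ball 0 1. f z = T (Some (\<eta> * z)))"
    then obtain T \<eta> where T: "T \<in> Rot" and f: "\<And>z. z \<in> ball 0 1 \<Longrightarrow> f z = T (Some (\<eta> * z))" by blast
    have holo: "(\<lambda>z. \<eta> * z) holomorphic_on ball 0 1" by (intro holomorphic_intros)
    have deriv_mult_id: "deriv (\<lambda>z. \<eta> * z) 0 = \<eta>" by simp
    show "spherical_area f r = pi * r\<^sup>2 / (1 + r\<^sup>2 * (spherical_deriv f 0)\<^sup>2) * (spherical_deriv f 0)\<^sup>2"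
      using linear_area_eq[of r \<eta>] r
      by (simp only: bound[OF T holo _ f] spherical_area_Rot[OF T holo f inj] mult_zero_right deriv_mult_id)
  qed
qed

end
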